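(* Sequential and parallel composition of ala-lenses are compatible with ala-lens equivalence, and they give rise to a symmetric monoidal category $\mathbf{ALaLens}$ whose objects are (small) categories and whose arrows from $\mathbf{A}$ to $\mathbf{B}$ are equivalence classes of ala-lenses from $\mathbf{A}$ to $\mathbf{B}$, with composition given by sequential composition, identities given by the identity lenses, monoidal product given by Cartesian product of categories on objects and parallel composition on arrows, monoidal unit the terminal category $\mathbf{1}$, and associators, unitors and braiding given by the iso-lenses induced by the corresponding canonical isomorphisms of categories.
   Context: Notation: $|\mathbf{X}|$ is the class of objects of $\mathbf{X}$; composition is diagrammatic, $u;u'$. $\mathbf{1}$ is the terminal category with single object $*$. Ala-lens from $\mathbf{S}$ to $\mathbf{T}$ with parameter category $\mathbf{P}$: a pair $(\mathrm{get},\mathrm{put})$ where $\mathrm{get}:\mathbf{P}\to[\mathbf{S},\mathbf{T}]$ is a functor (write $\mathrm{get}_p$, $S_p=\mathrm{get}_p(S)$, and $\mathrm{get}_e:\mathrm{get}_p\Rightarrow\mathrm{get}_{p'}$ for $e:p\to p'$), and $\mathrm{put}$ consists of three families indexed by $(p,S)\in|\mathbf{P}|\times|\mathbf{S}|$ assigning to every $v:S_p\to T'$ in $\mathbf{T}$ arrows $\mathrm{put}^{\mathrm{upd}}_{p,S}(v):p\to p'$ in $\mathbf{P}$, $\mathrm{put}^{\mathrm{req}}_{p,S}(v):S\to S'$ in $\mathbf{S}$, and $\mathrm{put}^{\mathrm{self}}_{p,S}(v):T'\to\mathrm{get}_{p'}(S')$ in $\mathbf{T}$. Equivalence: two ala-lenses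 $\ell=(\mathrm{get},\mathrm{put})$ and $\hat\ell=(\widehat{\mathrm{get}},\widehat{\mathrm{put}})$ from $\mathbf{S}$ to $\mathbf{T}$ with parameter categories $\mathbf{P},\hat{\mathbf{P}}$ are equivalent if there is an isomorphism of categories $\alpha:\mathbf{P}\to\hat{\mathbf{P}}$ such that for all $A\in|\mathbf{S}|$, $e:p\to p'$ in $\mathbf{P}$ and $v:\mathrm{get}_p(A)\to T'$: $\mathrm{get}_e(A)=\widehat{\mathrm{get}}_{\alpha(e)}(A)$, $\alpha(\mathrm{put}^{\mathrm{upd}}_{p,A}(v))=\widehat{\mathrm{put}}^{\mathrm{upd}}_{\alpha(p),A}(v)$, and $\mathrm{put}^{x}_{p,A}(v)=\widehat{\mathrm{put}}^{x}_{\alpha(p),A}(v)$ for $x\in\{\mathrm{req},\mathrm{self}\}$. Identity lens on $\mathbf{A}$: parameter category $\mathbf{1}$, $\mathrm{get}_*=\mathrm{id}_{\mathbf{A}}$, all puts identities (req returns $v$ itself, upd returns $\mathrm{id}_*$, self returns an identity). Iso-lens of an isomorphism $\iota:\mathbf{A}\to\mathbf{B}$: parameter category $\mathbf{1}$, $\mathrm{get}_*=\iota$, $\mathrm{put}^{\mathrm{req}}_{*,A}(v)=\iota^{-1}(v)$, other puts return identities. Sequential composition of $\kappa:\mathbf{A}\to\mathbf{B}$ (parameters $\mathbf{P}$) and $\ell:\mathbf{B}\to\mathbf{C}$ (parameters $\mathbf{Q}$): parameters $\mathbf{P}\times\mathbf{Q}$, $\mathrm{get}_{(p,q)}=\mathrm{get}^\kappa_p;\mathrm{get}^\ell_q$,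 $\mathrm{get}_{(e,h)}$ the horizontal composite of $\mathrm{get}^\kappa_e,\mathrm{get}^\ell_h$; for $w:\mathrm{get}^\ell_q(B)\to C'$ with $B=\mathrm{get}^\kappa_p(A)$: let $h=\mathrm{put}^{\ell,\mathrm{upd}}_{q,B}(w):q\to q'$, $v=\mathrm{put}^{\ell,\mathrm{req}}_{q,B}(w)$, $w^@=\mathrm{put}^{\ell,\mathrm{self}}_{q,B}(w)$, $e=\mathrm{put}^{\kappa,\mathrm{upd}}_{p,A}(v)$, $u=\mathrm{put}^{\kappa,\mathrm{req}}_{p,A}(v)$, $v^@=\mathrm{put}^{\kappa,\mathrm{self}}_{p,A}(v)$; then the composite's puts return $(e,h)$, $u$, and $w^@;\mathrm{get}^\ell_{q'}(v^@)$ respectively. Parallel composition of $\ell_i:\mathbf{A}_i\to\mathbf{B}_i$ (parameters $\mathbf{P}_i$): an ala-lens $\mathbf{A}_1\times\mathbf{A}_2\to\mathbf{B}_1\times\mathbf{B}_2$ with parameters $\mathbf{P}_1\times\mathbf{P}_2$, $\mathrm{get}_{(p_1,p_2)}=\mathrm{get}^{\ell_1}_{p_1}\times\mathrm{get}^{\ell_2}_{p_2}$, and all three put operations defined componentwise.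
   Formalization: Lens equivalence here also requires the functors get_p and get^_{α(p)} to agree on arrows, not only the components get_e(A) at objects; with components alone, sequential composition does not respect equivalence (take two different homomorphisms of one-object groups as get). *)

theory Defs
  imports "HOL-Library.FuncSet"
begin

section \<open>Categories, functors and natural transformations\<close>

record ('o, 'a) cat =
  Obj :: "'o set"
  Arr :: "'a set"
  Dom :: "'a \<Rightarrow> 'o"
  Cod :: "'a \<Rightarrow> 'o"
  Ide :: "'o \<Rightarrow> 'a"
  Comp :: "'a \<Rightarrow> 'a \<Rightarrow> 'a" (infixl "\<Zsemi>\<index>" 70) \<comment> \<open>diagrammatic order\<close>

definition hom :: "('o, 'a, 'x) cat_scheme \<Rightarrow> 'o \<Rightarrow> 'o \<Rightarrow> 'a set" where
  "hom C X Y = {f \<in> Arr C. Dom C f = X \<and> Cod C f = Y}"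

locale category =
  fixes C :: "('o, 'a, 'x) cat_scheme" (structure)
  assumes dom_obj: "f \<in> Arr C \<Longrightarrow> Dom C f \<in> Obj C"
    and cod_obj: "f \<in> Arr C \<Longrightarrow> Cod C f \<in> Obj C"
    and ide_hom: "X \<in> Obj C \<Longrightarrow> Ide C X \<in> hom C X X"
    and comp_hom: "\<lbrakk>f \<in> hom C X Y; g \<in> hom C Y Z\<rbrakk> \<Longrightarrow> f \<Zsemi> g \<in> hom C X Z"
    and comp_ide_left: "f \<in> hom C X Y \<Longrightarrow> Ide C X \<Zsemi> f = f"
    and comp_ide_right: "f \<in> hom C X Y \<Longrightarrow> f \<Zsemi> Ide C Y = f"
    and comp_assoc: "\<lbrakk>f \<in> hom C W X; g \<in> hom C X Y; h \<in> hom C Y Z\<rbrakk>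
      \<Longrightarrow> (f \<Zsemi> g) \<Zsemi> h = f \<Zsemi> (g \<Zsemi> h)"

definition is_iso :: "('o, 'a, 'x) cat_scheme \<Rightarrow> 'a \<Rightarrow> bool" where
  "is_iso C f \<longleftrightarrow> f \<in> Arr C \<and>
     (\<exists>g \<in> hom C (Cod C f) (Dom C f).
        f \<Zsemi>\<^bsub>C\<^esub> g = Ide C (Dom C f) \<and> g \<Zsemi>\<^bsub>C\<^esub> f = Ide C (Cod C f))"

record ('o, 'a, 'p, 'b) fnctr =
  fobj :: "'o \<Rightarrow> 'p"
  farr :: "'a \<Rightarrow> 'b"

definition is_functor ::
  "('o, 'a) cat \<Rightarrow> ('p, 'b) cat \<Rightarrow> ('o, 'a, 'p, 'b) fnctr \<Rightarrow> bool" where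
  "is_functor C D F \<longleftrightarrow>
     (\<forall>X \<in> Obj C. fobj F X \<in> Obj D) \<and>
     (\<forall>f \<in> Arr C. farr F f \<in> hom D (fobj F (Dom C f)) (fobj F (Cod C f))) \<and>
     (\<forall>X \<in> Obj C. farr F (Ide C X) = Ide D (fobj F X)) \<and>
     (\<forall>f \<in> Arr C. \<forall>g \<in> Arr C. Cod C f = Dom C g \<longrightarrow>
        farr F (f \<Zsemi>\<^bsub>C\<^esub> g) = farr F f \<Zsemi>\<^bsub>D\<^esub> farr F g)"

definition functor_eq ::
  "('o, 'a) cat \<Rightarrow> ('o, 'a, 'p, 'b) fnctr \<Rightarrow> ('o, 'a, 'p, 'b) fnctr \<Rightarrow> bool" where
  "functor_eq C F G \<longleftrightarrow>
     (\<forall>X \<in> Obj C. fobj F X = fobj G X) \<and> (\<forall>f \<in> Arr C. farr F f = farr G f)"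

definition id_functor :: "('o, 'a, 'o, 'a) fnctr" where
  "id_functor = \<lparr>fobj = (\<lambda>X. X), farr = (\<lambda>f. f)\<rparr>"

definition comp_functor ::
  "('o, 'a, 'p, 'b) fnctr \<Rightarrow> ('p, 'b, 'q, 'c) fnctr \<Rightarrow> ('o, 'a, 'q, 'c) fnctr" where
  "comp_functor F G = \<lparr>fobj = (\<lambda>X. fobj G (fobj F X)), farr = (\<lambda>f. farr G (farr F f))\<rparr>"

definition is_cat_iso ::
  "('o, 'a) cat \<Rightarrow> ('p, 'b) cat \<Rightarrow> ('o, 'a, 'p, 'b) fnctr \<Rightarrow> bool" where
  "is_cat_iso C D F \<longleftrightarrow> is_functor C D F \<and>
     (\<exists>G. is_functor D C G \<and> functor_eq C (comp_functor F G) id_functor \<and>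
        functor_eq D (comp_functor G F) id_functor)"

definition is_nat_trans ::
  "('o, 'a) cat \<Rightarrow> ('p, 'b) cat \<Rightarrow> ('o, 'a, 'p, 'b) fnctr \<Rightarrow> ('o, 'a, 'p, 'b) fnctr
    \<Rightarrow> ('o \<Rightarrow> 'b) \<Rightarrow> bool" where
  "is_nat_trans C D F G \<eta> \<longleftrightarrow>
     (\<forall>X \<in> Obj C. \<eta> X \<in> hom D (fobj F X) (fobj G X)) \<and>
     (\<forall>f \<in> Arr C. farr F f \<Zsemi>\<^bsub>D\<^esub> \<eta> (Cod C f) = \<eta> (Dom C f) \<Zsemi>\<^bsub>D\<^esub> farr G f)"


section \<open>Symmetric monoidal categories\<close>

record ('o, 'a) monoidal = "('o, 'a) cat" +
  munit :: "'o"
  tens :: "'o \<Rightarrow> 'o \<Rightarrow> 'o"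
  tensa :: "'a \<Rightarrow> 'a \<Rightarrow> 'a"
  associator :: "'o \<Rightarrow> 'o \<Rightarrow> 'o \<Rightarrow> 'a"
  lunitor :: "'o \<Rightarrow> 'a"
  runitor :: "'o \<Rightarrow> 'a"
  braiding :: "'o \<Rightarrow> 'o \<Rightarrow> 'a"

locale symmetric_monoidal_category = category M
  for M :: "('o, 'a) monoidal" (structure) +
  assumes unit_obj: "munit M \<in> Obj M"
    and tens_obj: "\<lbrakk>X \<in> Obj M; Y \<in> Obj M\<rbrakk> \<Longrightarrow> tens M X Y \<in> Obj M"
    and tens_hom: "\<lbrakk>f \<in> hom M X X'; g \<in> hom M Y Y'\<rbrakk>
      \<Longrightarrow> tensa M f g \<in> hom M (tens M X Y) (tens M X' Y')"
    and tens_ide: "\<lbrakk>X \<in> Obj M; Y \<in> Obj M\<rbrakk>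
      \<Longrightarrow> tensa M (Ide M X) (Ide M Y) = Ide M (tens M X Y)"
    and tens_comp: "\<lbrakk>f \<in> hom M X X'; f' \<in> hom M X' X''; g \<in> hom M Y Y'; g' \<in> hom M Y' Y''\<rbrakk>
      \<Longrightarrow> tensa M (f \<Zsemi> f') (g \<Zsemi> g') = tensa M f g \<Zsemi> tensa M f' g'"
    and assoc_hom: "\<lbrakk>X \<in> Obj M; Y \<in> Obj M; Z \<in> Obj M\<rbrakk>
      \<Longrightarrow> associator M X Y Z \<in> hom M (tens M (tens M X Y) Z) (tens M X (tens M Y Z))"
    and assoc_iso: "\<lbrakk>X \<in> Obj M; Y \<in> Obj M; Z \<in> Obj M\<rbrakk> \<Longrightarrow> is_iso M (associator M X Y Z)"
    and assoc_natural: "\<lbrakk>f \<in> hom M X X'; g \<in> hom M Y Y'; h \<in> hom M Z Z'\<rbrakk>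
      \<Longrightarrow> tensa M (tensa M f g) h \<Zsemi> associator M X' Y' Z'
          = associator M X Y Z \<Zsemi> tensa M f (tensa M g h)"
    and lunit_hom: "X \<in> Obj M \<Longrightarrow> lunitor M X \<in> hom M (tens M (munit M) X) X"
    and lunit_iso: "X \<in> Obj M \<Longrightarrow> is_iso M (lunitor M X)"
    and lunit_natural: "f \<in> hom M X X'
      \<Longrightarrow> tensa M (Ide M (munit M)) f \<Zsemi> lunitor M X' = lunitor M X \<Zsemi> f"
    and runit_hom: "X \<in> Obj M \<Longrightarrow> runitor M X \<in> hom M (tens M X (munit M)) X"
    and runit_iso: "X \<in> Obj M \<Longrightarrow> is_iso M (runitor M X)"
    and runit_natural: "f \<in> hom M X X'
      \<Longrightarrow> tensa M f (Ide M (munit M)) \<Zsemi> runitor M X' = runitor M X \<Zsemi> f"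
    and pentagon: "\<lbrakk>W \<in> Obj M; X \<in> Obj M; Y \<in> Obj M; Z \<in> Obj M\<rbrakk>
      \<Longrightarrow> associator M (tens M W X) Y Z \<Zsemi> associator M W X (tens M Y Z)
          = tensa M (associator M W X Y) (Ide M Z) \<Zsemi> associator M W (tens M X Y) Z
            \<Zsemi> tensa M (Ide M W) (associator M X Y Z)"
    and triangle: "\<lbrakk>X \<in> Obj M; Y \<in> Obj M\<rbrakk>
      \<Longrightarrow> associator M X (munit M) Y \<Zsemi> tensa M (Ide M X) (lunitor M Y)
          = tensa M (runitor M X) (Ide M Y)"
    and braid_hom: "\<lbrakk>X \<in> Obj M; Y \<in> Obj M\<rbrakk>
      \<Longrightarrow> braiding M X Y \<in> hom M (tens M X Y) (tens M Y X)"
    and braid_natural: "\<lbrakk>f \<in> hom M X X'; g \<in> hom M Y Y'\<rbrakk>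
      \<Longrightarrow> tensa M f g \<Zsemi> braiding M X' Y' = braiding M X Y \<Zsemi> tensa M g f"
    and braid_symmetric: "\<lbrakk>X \<in> Obj M; Y \<in> Obj M\<rbrakk>
      \<Longrightarrow> braiding M X Y \<Zsemi> braiding M Y X = Ide M (tens M X Y)"
    and hexagon: "\<lbrakk>X \<in> Obj M; Y \<in> Obj M; Z \<in> Obj M\<rbrakk>
      \<Longrightarrow> associator M X Y Z \<Zsemi> braiding M X (tens M Y Z) \<Zsemi> associator M Y Z X
          = tensa M (braiding M X Y) (Ide M Z) \<Zsemi> associator M Y X Z
            \<Zsemi> tensa M (Ide M Y) (braiding M X Z)"


section \<open>Small categories\<close>

text \<open>To collect all small categories in one type, their objects and arrows are drawn from a
  universe that contains the elements of an arbitrary type, the object of the terminal category,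
  and ordered pairs. Smallness is any predicate on subsets of that universe that holds for
  singletons and is preserved by Cartesian products; for instance the predicate that is always
  true, or ``of cardinality less than \<open>\<kappa>\<close>'' for an infinite cardinal \<open>\<kappa>\<close>.\<close>

datatype 'a univ = Star | Atom 'a | Pr (pfst: "'a univ") (psnd: "'a univ")

definition pset :: "'a univ set \<Rightarrow> 'a univ set \<Rightarrow> 'a univ set" where
  "pset A B = {Pr x y | x y. x \<in> A \<and> y \<in> B}"

locale smallness =
  fixes small :: "'a univ set \<Rightarrow> bool"
  assumes small_singleton: "small {x}"
    and small_pset: "\<lbrakk>small A; small B\<rbrakk> \<Longrightarrow> small (pset A B)"

type_synonym 'a ucat = "('a univ, 'a univ) cat"
type_synonym 'a ufun = "('a univ, 'a univ, 'a univ, 'a univ) fnctr"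

text \<open>The operations of a small category are undefined outside their domains, so that
  equality of records is equality of categories.\<close>

definition small_category :: "('a univ set \<Rightarrow> bool) \<Rightarrow> 'a ucat \<Rightarrow> bool" where
  "small_category small C \<longleftrightarrow> category C \<and> small (Obj C) \<and> small (Arr C) \<and>
     Dom C \<in> extensional (Arr C) \<and> Cod C \<in> extensional (Arr C) \<and>
     Ide C \<in> extensional (Obj C) \<and>
     (\<forall>f g. \<not> (f \<in> Arr C \<and> g \<in> Arr C \<and> Cod C f = Dom C g) \<longrightarrow> f \<Zsemi>\<^bsub>C\<^esub> g = undefined)"

definition one_cat :: "'a ucat" where
  "one_cat = \<lparr>
     Obj = {Star},
     Arr = {Star},
     Dom = (\<lambda>f \<in> {Star}. Star),
     Cod = (\<lambda>f \<in> {Star}. Star),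
     Ide = (\<lambda>X \<in> {Star}. Star),
     Comp = (\<lambda>f g. if f = Star \<and> g = Star then Star else undefined)\<rparr>"

definition prod_cat :: "'a ucat \<Rightarrow> 'a ucat \<Rightarrow> 'a ucat" where
  "prod_cat C D = \<lparr>
     Obj = pset (Obj C) (Obj D),
     Arr = pset (Arr C) (Arr D),
     Dom = (\<lambda>f \<in> pset (Arr C) (Arr D). Pr (Dom C (pfst f)) (Dom D (psnd f))),
     Cod = (\<lambda>f \<in> pset (Arr C) (Arr D). Pr (Cod C (pfst f)) (Cod D (psnd f))),
     Ide = (\<lambda>X \<in> pset (Obj C) (Obj D). Pr (Ide C (pfst X)) (Ide D (psnd X))),
     Comp = (\<lambda>f g.
       if f \<in> pset (Arr C) (Arr D) \<and> g \<in> pset (Arr C) (Arr D) \<and>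
          Cod C (pfst f) = Dom C (pfst g) \<and> Cod D (psnd f) = Dom D (psnd g)
       then Pr (pfst f \<Zsemi>\<^bsub>C\<^esub> pfst g) (psnd f \<Zsemi>\<^bsub>D\<^esub> psnd g)
       else undefined)\<rparr>"

definition prod_functor :: "'a ufun \<Rightarrow> 'a ufun \<Rightarrow> 'a ufun" where
  "prod_functor F G = \<lparr>
     fobj = (\<lambda>X. Pr (fobj F (pfst X)) (fobj G (psnd X))),
     farr = (\<lambda>f. Pr (farr F (pfst f)) (farr G (psnd f)))\<rparr>"

text \<open>The canonical isomorphisms act by the same formula on objects and on arrows.\<close>

definition same_functor :: "('a univ \<Rightarrow> 'a univ) \<Rightarrow> 'a ufun" where
  "same_functor \<phi> = \<lparr>fobj = \<phi>, farr = \<phi>\<rparr>"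

definition assoc_functor :: "'a ufun" where
  "assoc_functor = same_functor (\<lambda>x. Pr (pfst (pfst x)) (Pr (psnd (pfst x)) (psnd x)))"

definition lunit_functor :: "'a ufun" where
  "lunit_functor = same_functor psnd"

definition runit_functor :: "'a ufun" where
  "runit_functor = same_functor pfst"

definition swap_functor :: "'a ufun" where
  "swap_functor = same_functor (\<lambda>x. Pr (psnd x) (pfst x))"


section \<open>Ala-lenses\<close>

record 'a lens =
  src :: "'a ucat"
  tgt :: "'a ucat"
  params :: "'a ucat"
  get :: "'a univ \<Rightarrow> 'a ufun" \<comment> \<open>\<open>get l p\<close> is the functor \<open>get\<^sub>p\<close>\<close>
  get_nt :: "'a univ \<Rightarrow> 'a univ \<Rightarrow> 'a univ" \<comment> \<open>\<open>get_nt l e A\<close> is the component of \<open>get\<^sub>e\<close> at \<open>A\<close>\<close>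
  put_upd :: "'a univ \<Rightarrow> 'a univ \<Rightarrow> 'a univ \<Rightarrow> 'a univ"
  put_req :: "'a univ \<Rightarrow> 'a univ \<Rightarrow> 'a univ \<Rightarrow> 'a univ"
  put_self :: "'a univ \<Rightarrow> 'a univ \<Rightarrow> 'a univ \<Rightarrow> 'a univ"

definition put_dom :: "'a lens \<Rightarrow> ('a univ \<times> 'a univ \<times> 'a univ) set" where
  "put_dom l = {(p, A, v). p \<in> Obj (params l) \<and> A \<in> Obj (src l) \<and>
     v \<in> Arr (tgt l) \<and> Dom (tgt l) v = fobj (get l p) A}"

text \<open>The four clauses on \<open>get\<close> spell out that it is a functor from the parameter category to
  the category of functors from source to target and natural transformations between them.\<close>

definition ala_lens :: "('a univ set \<Rightarrow> bool) \<Rightarrow> 'a lens \<Rightarrow> bool" where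
  "ala_lens small l \<longleftrightarrow> (let S = src l; T = tgt l; P = params l in
     small_category small S \<and> small_category small T \<and> small_category small P \<and>
     (\<forall>p \<in> Obj P. is_functor S T (get l p)) \<and>
     (\<forall>e \<in> Arr P. is_nat_trans S T (get l (Dom P e)) (get l (Cod P e)) (get_nt l e)) \<and>
     (\<forall>p \<in> Obj P. \<forall>A \<in> Obj S. get_nt l (Ide P p) A = Ide T (fobj (get l p) A)) \<and>
     (\<forall>e \<in> Arr P. \<forall>e' \<in> Arr P. Cod P e = Dom P e' \<longrightarrow>
        (\<forall>A \<in> Obj S. get_nt l (e \<Zsemi>\<^bsub>P\<^esub> e') A = get_nt l e A \<Zsemi>\<^bsub>T\<^esub> get_nt l e' A)) \<and>
     (\<forall>(p, A, v) \<in> put_dom l. \<exists>p' A'.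
        put_upd l p A v \<in> hom P p p' \<and>
        put_req l p A v \<in> hom S A A' \<and>
        put_self l p A v \<in> hom T (Cod T v) (fobj (get l p') A')))"

text \<open>Corresponding values of \<open>get\<close> are required to be equal as arrows of the functor category:
  not only the components of the natural transformations agree, but also the functors they
  connect, including the action of these functors on arrows. Sequential composition would not
  respect a relation that ignores that action, because its \<open>put_self\<close> applies \<open>get\<close> to an arrow.\<close>

definition lens_equivalent :: "'a lens \<Rightarrow> 'a lens \<Rightarrow> bool" where
  "lens_equivalent k l \<longleftrightarrow> src k = src l \<and> tgt k = tgt l \<and>
     (\<exists>\<alpha>. is_cat_iso (params k) (params l) \<alpha> \<and>
        (\<forall>p \<in> Obj (params k). functor_eq (src k) (get k p) (get l (fobj \<alpha> p))) \<and>
        (\<forall>e \<in> Arr (params k). \<forall>A \<in> Obj (src k). get_nt k e A = get_nt l (farr \<alpha> e) A) \<and>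
        (\<forall>(p, A, v) \<in> put_dom k.
           farr \<alpha> (put_upd k p A v) = put_upd l (fobj \<alpha> p) A v \<and>
           put_req k p A v = put_req l (fobj \<alpha> p) A v \<and>
           put_self k p A v = put_self l (fobj \<alpha> p) A v))"

definition lens_eq :: "('a univ set \<Rightarrow> bool) \<Rightarrow> ('a lens \<times> 'a lens) set" where
  "lens_eq small = {(k, l). ala_lens small k \<and> ala_lens small l \<and> lens_equivalent k l}"

definition id_lens :: "'a ucat \<Rightarrow> 'a lens" where
  "id_lens A = \<lparr>
     src = A, tgt = A, params = one_cat,
     get = (\<lambda>p. id_functor),
     get_nt = (\<lambda>e X. Ide A X),
     put_upd = (\<lambda>p X v. Ide one_cat Star),
     put_req = (\<lambda>p X v. v),
     put_self = (\<lambda>p X v. Ide A (Cod A v))\<rparr>"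

definition iso_lens :: "'a ucat \<Rightarrow> 'a ucat \<Rightarrow> 'a ufun \<Rightarrow> 'a lens" where
  "iso_lens A B F = \<lparr>
     src = A, tgt = B, params = one_cat,
     get = (\<lambda>p. F),
     get_nt = (\<lambda>e X. Ide B (fobj F X)),
     put_upd = (\<lambda>p X v. Ide one_cat Star),
     put_req = (\<lambda>p X v. inv_into (Arr A) (farr F) v),
     put_self = (\<lambda>p X v. Ide B (Cod B v))\<rparr>"

definition seq_lens :: "'a lens \<Rightarrow> 'a lens \<Rightarrow> 'a lens" where
  "seq_lens k l = \<lparr>
     src = src k, tgt = tgt l, params = prod_cat (params k) (params l),
     get = (\<lambda>r. comp_functor (get k (pfst r)) (get l (psnd r))),
     get_nt = (\<lambda>r A. let e = pfst r; h = psnd r; q = Dom (params l) h; p' = Cod (params k) e in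
       farr (get l q) (get_nt k e A) \<Zsemi>\<^bsub>tgt l\<^esub> get_nt l h (fobj (get k p') A)),
     put_upd = (\<lambda>r A w. let p = pfst r; q = psnd r; B = fobj (get k p) A;
         v = put_req l q B w
       in Pr (put_upd k p A v) (put_upd l q B w)),
     put_req = (\<lambda>r A w. let p = pfst r; q = psnd r; B = fobj (get k p) A;
         v = put_req l q B w
       in put_req k p A v),
     put_self = (\<lambda>r A w. let p = pfst r; q = psnd r; B = fobj (get k p) A;
         q' = Cod (params l) (put_upd l q B w);
         v = put_req l q B w
       in put_self l q B w \<Zsemi>\<^bsub>tgt l\<^esub> farr (get l q') (put_self k p A v))\<rparr>"

definition par_lens :: "'a lens \<Rightarrow> 'a lens \<Rightarrow> 'a lens" where
  "par_lens k l = \<lparr>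
     src = prod_cat (src k) (src l), tgt = prod_cat (tgt k) (tgt l),
     params = prod_cat (params k) (params l),
     get = (\<lambda>p. prod_functor (get k (pfst p)) (get l (psnd p))),
     get_nt = (\<lambda>e A. Pr (get_nt k (pfst e) (pfst A)) (get_nt l (psnd e) (psnd A))),
     put_upd = (\<lambda>p A v. Pr (put_upd k (pfst p) (pfst A) (pfst v)) (put_upd l (psnd p) (psnd A) (psnd v))),
     put_req = (\<lambda>p A v. Pr (put_req k (pfst p) (pfst A) (pfst v)) (put_req l (psnd p) (psnd A) (psnd v))),
     put_self = (\<lambda>p A v. Pr (put_self k (pfst p) (pfst A) (pfst v)) (put_self l (psnd p) (psnd A) (psnd v)))\<rparr>"


section \<open>The category of ala-lenses\<close>

definition lens_class :: "('a univ set \<Rightarrow> bool) \<Rightarrow> 'a lens \<Rightarrow> 'a lens set" where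
  "lens_class small l = lens_eq small `` {l}"

definition ALaLens :: "('a univ set \<Rightarrow> bool) \<Rightarrow> ('a ucat, 'a lens set) monoidal" where
  "ALaLens small = \<lparr>
     Obj = {A. small_category small A},
     Arr = {l. ala_lens small l} // lens_eq small,
     Dom = (\<lambda>X. the_elem (src ` X)),
     Cod = (\<lambda>X. the_elem (tgt ` X)),
     Ide = (\<lambda>A. lens_class small (id_lens A)),
     Comp = (\<lambda>X Y. \<Union>k \<in> X. \<Union>l \<in> Y. lens_class small (seq_lens k l)),
     munit = one_cat,
     tens = prod_cat,
     tensa = (\<lambda>X Y. \<Union>k \<in> X. \<Union>l \<in> Y. lens_class small (par_lens k l)),
     associator = (\<lambda>A B C. lens_class small
       (iso_lens (prod_cat (prod_cat A B) C) (prod_cat A (prod_cat B C)) assoc_functor)),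
     lunitor = (\<lambda>A. lens_class small (iso_lens (prod_cat one_cat A) A lunit_functor)),
     runitor = (\<lambda>A. lens_class small (iso_lens (prod_cat A one_cat) A runit_functor)),
     braiding = (\<lambda>A B. lens_class small (iso_lens (prod_cat A B) (prod_cat B A) swap_functor))\<rparr>"

end

theory Submission
  imports Defs
begin

text \<open>Every axiom is an equality of equivalence classes of lenses, hence an isomorphism of
  parameter categories that transports one lens to the other. Associativity and interchange of
  sequential and parallel composition use the associativity and middle-four isomorphisms of
  products. For the naturality squares it suffices that the two lenses agree up to
  isomorphisms of sources, targets and parameters. The coherence laws only involve iso-lenses,
  and there they reduce to equalities of functors, because \<open>iso_lens\<close> preserves composition and
  products up to equivalence.\<close>

text \<open>Associativity and the unit laws cannot be expected as equations of lenses: (P x Q) x R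
  and P x (Q x R) are different parameter categories, and an identity lens contributes an extra
  factor 1. Equivalence absorbs this discrepancy by isomorphisms of parameter categories, while
  sources and targets stay fixed. The encoding is a second obstacle. Functors are pairs of total
  functions, so two constructions of the same functor agree only on the objects and arrows of its
  domain, and the inverse in an iso-lens is chosen by \<open>inv_into\<close>. Hence functors are
  compared pointwise, and the class of an iso-lens has to be shown independent of values outside the
  domain. Once this is known, sending an isomorphism to the class of its iso-lens behaves like a
  strict monoidal functor on the groupoid of small categories, where the coherence laws hold
  pointwise on nested pairs. Naturality escapes this argument, since it concerns arbitrary
  lenses.\<close>

section \<open>Functors and isomorphisms of categories\<close>

text \<open>In several locale axioms an object, such as the midpoint of a composite, occurs only in
  the premises. With \<open>Dom\<close> and \<open>Cod\<close> the side conditions are computed from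
  the arrows, so that these forms can serve as rewrite rules.\<close>

lemma category_simps:
  assumes "category C"
  shows category_Dom: "f \<in> Arr C \<Longrightarrow> Dom C f \<in> Obj C"
    and category_Cod: "f \<in> Arr C \<Longrightarrow> Cod C f \<in> Obj C"
    and category_Ide: "X \<in> Obj C \<Longrightarrow> Ide C X \<in> Arr C"
    and category_Dom_Ide: "X \<in> Obj C \<Longrightarrow> Dom C (Ide C X) = X"
    and category_Cod_Ide: "X \<in> Obj C \<Longrightarrow> Cod C (Ide C X) = X"
    and category_Comp: "\<lbrakk>f \<in> Arr C; g \<in> Arr C; Cod C f = Dom C g\<rbrakk> \<Longrightarrow> f \<Zsemi>\<^bsub>C\<^esub> g \<in> Arr C"
    and category_Dom_Comp: "\<lbrakk>f \<in> Arr C; g \<in> Arr C; Cod C f = Dom C g\<rbrakk>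
      \<Longrightarrow> Dom C (f \<Zsemi>\<^bsub>C\<^esub> g) = Dom C f"
    and category_Cod_Comp: "\<lbrakk>f \<in> Arr C; g \<in> Arr C; Cod C f = Dom C g\<rbrakk>
      \<Longrightarrow> Cod C (f \<Zsemi>\<^bsub>C\<^esub> g) = Cod C g"
    and category_Ide_left: "\<lbrakk>f \<in> Arr C; Dom C f = X\<rbrakk> \<Longrightarrow> Ide C X \<Zsemi>\<^bsub>C\<^esub> f = f"
    and category_Ide_right: "\<lbrakk>f \<in> Arr C; Cod C f = X\<rbrakk> \<Longrightarrow> f \<Zsemi>\<^bsub>C\<^esub> Ide C X = f"
    and category_assoc: "\<lbrakk>f \<in> Arr C; g \<in> Arr C; h \<in> Arr C; Cod C f = Dom C g; Cod C g = Dom C h\<rbrakk>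
      \<Longrightarrow> (f \<Zsemi>\<^bsub>C\<^esub> g) \<Zsemi>\<^bsub>C\<^esub> h = f \<Zsemi>\<^bsub>C\<^esub> (g \<Zsemi>\<^bsub>C\<^esub> h)"
proof -
  interpret category C by fact
  show "f \<in> Arr C \<Longrightarrow> Dom C f \<in> Obj C" "f \<in> Arr C \<Longrightarrow> Cod C f \<in> Obj C"
    by (fact dom_obj cod_obj)+
  show "X \<in> Obj C \<Longrightarrow> Ide C X \<in> Arr C" "X \<in> Obj C \<Longrightarrow> Dom C (Ide C X) = X"
    "X \<in> Obj C \<Longrightarrow> Cod C (Ide C X) = X"
    using ide_hom[of X] by (auto simp: hom_def)
  show "\<lbrakk>f \<in> Arr C; g \<in> Arr C; Cod C f = Dom C g\<rbrakk> \<Longrightarrow> f \<Zsemi>\<^bsub>C\<^esub> g \<in> Arr C"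
    "\<lbrakk>f \<in> Arr C; g \<in> Arr C; Cod C f = Dom C g\<rbrakk> \<Longrightarrow> Dom C (f \<Zsemi>\<^bsub>C\<^esub> g) = Dom C f"
    "\<lbrakk>f \<in> Arr C; g \<in> Arr C; Cod C f = Dom C g\<rbrakk> \<Longrightarrow> Cod C (f \<Zsemi>\<^bsub>C\<^esub> g) = Cod C g"
    using comp_hom[of f "Dom C f" "Cod C f" g "Cod C g"] by (auto simp: hom_def)
  show "\<lbrakk>f \<in> Arr C; Dom C f = X\<rbrakk> \<Longrightarrow> Ide C X \<Zsemi>\<^bsub>C\<^esub> f = f"
    using comp_ide_left[of f X "Cod C f"] by (auto simp: hom_def)
  show "\<lbrakk>f \<in> Arr C; Cod C f = X\<rbrakk> \<Longrightarrow> f \<Zsemi>\<^bsub>C\<^esub> Ide C X = f"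
    using comp_ide_right[of f "Dom C f" X] by (auto simp: hom_def)
  show "\<lbrakk>f \<in> Arr C; g \<in> Arr C; h \<in> Arr C; Cod C f = Dom C g; Cod C g = Dom C h\<rbrakk>
      \<Longrightarrow> (f \<Zsemi>\<^bsub>C\<^esub> g) \<Zsemi>\<^bsub>C\<^esub> h = f \<Zsemi>\<^bsub>C\<^esub> (g \<Zsemi>\<^bsub>C\<^esub> h)"
    using comp_assoc[of f "Dom C f" "Cod C f" g "Cod C g" h "Cod C h"] by (auto simp: hom_def)
qed

lemma functor_simps:
  assumes "is_functor C D F"
  shows functor_Obj: "X \<in> Obj C \<Longrightarrow> fobj F X \<in> Obj D"
    and functor_Arr: "f \<in> Arr C \<Longrightarrow> farr F f \<in> Arr D"
    and functor_Dom: "f \<in> Arr C \<Longrightarrow> Dom D (farr F f) = fobj F (Dom C f)"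
    and functor_Cod: "f \<in> Arr C \<Longrightarrow> Cod D (farr F f) = fobj F (Cod C f)"
    and functor_Ide: "X \<in> Obj C \<Longrightarrow> farr F (Ide C X) = Ide D (fobj F X)"
    and functor_Comp: "\<lbrakk>f \<in> Arr C; g \<in> Arr C; Cod C f = Dom C g\<rbrakk>
      \<Longrightarrow> farr F (f \<Zsemi>\<^bsub>C\<^esub> g) = farr F f \<Zsemi>\<^bsub>D\<^esub> farr F g"
  using assms by (auto simp: is_functor_def hom_def)

lemma is_functorI:
  assumes "\<And>X. X \<in> Obj C \<Longrightarrow> fobj F X \<in> Obj D"
    and "\<And>f. f \<in> Arr C \<Longrightarrow> farr F f \<in> Arr D"
    and "\<And>f. f \<in> Arr C \<Longrightarrow> Dom D (farr F f) = fobj F (Dom C f)"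
    and "\<And>f. f \<in> Arr C \<Longrightarrow> Cod D (farr F f) = fobj F (Cod C f)"
    and "\<And>X. X \<in> Obj C \<Longrightarrow> farr F (Ide C X) = Ide D (fobj F X)"
    and "\<And>f g. \<lbrakk>f \<in> Arr C; g \<in> Arr C; Cod C f = Dom C g\<rbrakk>
      \<Longrightarrow> farr F (f \<Zsemi>\<^bsub>C\<^esub> g) = farr F f \<Zsemi>\<^bsub>D\<^esub> farr F g"
  shows "is_functor C D F"
  using assms by (auto simp: is_functor_def hom_def)

lemma is_functor_id: "is_functor C C id_functor"
  by (rule is_functorI) (auto simp: id_functor_def)

lemma comp_functor_sel [simp]:
  "fobj (comp_functor F G) X = fobj G (fobj F X)"
  "farr (comp_functor F G) f = farr G (farr F f)"
  by (simp_all add: comp_functor_def)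

lemma id_functor_sel [simp]: "fobj id_functor X = X" "farr id_functor f = f"
  by (simp_all add: id_functor_def)

lemma same_functor_sel [simp]: "fobj (same_functor \<phi>) X = \<phi> X" "farr (same_functor \<phi>) f = \<phi> f"
  by (simp_all add: same_functor_def)

lemma prod_functor_sel [simp]:
  "fobj (prod_functor F G) X = Pr (fobj F (pfst X)) (fobj G (psnd X))"
  "farr (prod_functor F G) f = Pr (farr F (pfst f)) (farr G (psnd f))"
  by (simp_all add: prod_functor_def)

lemma is_functor_comp:
  assumes "is_functor C D F" "is_functor D E G"
  shows "is_functor C E (comp_functor F G)"
  using assms by (intro is_functorI) (simp_all add: functor_simps[OF assms(1)]
    functor_simps[OF assms(2)])

lemma pset_iff [simp]: "Pr x y \<in> pset A B \<longleftrightarrow> x \<in> A \<and> y \<in> B"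
  by (auto simp: pset_def)

lemma psetE:
  assumes "z \<in> pset A B"
  obtains x y where "z = Pr x y" "x \<in> A" "y \<in> B"
  using assms by (auto simp: pset_def)

lemma prod_cat_sel [simp]:
  "Obj (prod_cat C D) = pset (Obj C) (Obj D)"
  "Arr (prod_cat C D) = pset (Arr C) (Arr D)"
  "\<lbrakk>f \<in> Arr C; g \<in> Arr D\<rbrakk> \<Longrightarrow> Dom (prod_cat C D) (Pr f g) = Pr (Dom C f) (Dom D g)"
  "\<lbrakk>f \<in> Arr C; g \<in> Arr D\<rbrakk> \<Longrightarrow> Cod (prod_cat C D) (Pr f g) = Pr (Cod C f) (Cod D g)"
  "\<lbrakk>X \<in> Obj C; Y \<in> Obj D\<rbrakk> \<Longrightarrow> Ide (prod_cat C D) (Pr X Y) = Pr (Ide C X) (Ide D Y)"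
  "\<lbrakk>f \<in> Arr C; g \<in> Arr D; f' \<in> Arr C; g' \<in> Arr D; Cod C f = Dom C f'; Cod D g = Dom D g'\<rbrakk>
    \<Longrightarrow> Pr f g \<Zsemi>\<^bsub>prod_cat C D\<^esub> Pr f' g' = Pr (f \<Zsemi>\<^bsub>C\<^esub> f') (g \<Zsemi>\<^bsub>D\<^esub> g')"
  by (simp_all add: prod_cat_def)

lemma one_cat_sel [simp]:
  "Obj one_cat = {Star}" "Arr one_cat = {Star}" "Dom one_cat Star = Star" "Cod one_cat Star = Star"
  "Ide one_cat Star = Star" "Star \<Zsemi>\<^bsub>one_cat\<^esub> Star = Star"
  by (simp_all add: one_cat_def)

lemma category_prod_cat:
  assumes "category C" "category D"
  shows "category (prod_cat C D)"
  by unfold_locales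
    (auto simp: hom_def category_simps[OF assms(1)] category_simps[OF assms(2)] elim!: psetE)

lemma category_one_cat: "category one_cat"
  by unfold_locales (auto simp: hom_def)

lemma is_functor_prod:
  assumes "is_functor C D F" "is_functor C' D' F'"
  shows "is_functor (prod_cat C C') (prod_cat D D') (prod_functor F F')"
  by (rule is_functorI)
    (auto simp: functor_simps[OF assms(1)] functor_simps[OF assms(2)] elim!: psetE)

section \<open>Natural transformations and horizontal composition\<close>

lemma is_nat_transD:
  assumes "is_nat_trans C D F G \<eta>"
  shows "X \<in> Obj C \<Longrightarrow> \<eta> X \<in> Arr D" "X \<in> Obj C \<Longrightarrow> Dom D (\<eta> X) = fobj F X"
    "X \<in> Obj C \<Longrightarrow> Cod D (\<eta> X) = fobj G X"
    "f \<in> Arr C \<Longrightarrow> farr F f \<Zsemi>\<^bsub>D\<^esub> \<eta> (Cod C f) = \<eta> (Dom C f) \<Zsemi>\<^bsub>D\<^esub> farr G f"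
  using assms by (auto simp: is_nat_trans_def hom_def)

lemma is_nat_transI:
  assumes "\<And>X. X \<in> Obj C \<Longrightarrow> \<eta> X \<in> Arr D" "\<And>X. X \<in> Obj C \<Longrightarrow> Dom D (\<eta> X) = fobj F X"
    "\<And>X. X \<in> Obj C \<Longrightarrow> Cod D (\<eta> X) = fobj G X"
    "\<And>f. f \<in> Arr C \<Longrightarrow> farr F f \<Zsemi>\<^bsub>D\<^esub> \<eta> (Cod C f) = \<eta> (Dom C f) \<Zsemi>\<^bsub>D\<^esub> farr G f"
  shows "is_nat_trans C D F G \<eta>"
  using assms by (auto simp: is_nat_trans_def hom_def)

text \<open>Naturality pastes two squares: the image under G of the square of \<eta> at f, and the
  square of \<theta> at \<open>farr F' f\<close>. This is what makes \<open>get_nt\<close> of a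
  sequential composite natural.\<close>

lemma is_nat_trans_hcomp:
  assumes C: "category C" and D: "category D" and E: "category E"
    and F: "is_functor C D F" and F': "is_functor C D F'"
    and G: "is_functor D E G" and G': "is_functor D E G'"
    and \<eta>: "is_nat_trans C D F F' \<eta>" and \<theta>: "is_nat_trans D E G G' \<theta>"
  shows "is_nat_trans C E (comp_functor F G) (comp_functor F' G')
    (\<lambda>X. farr G (\<eta> X) \<Zsemi>\<^bsub>E\<^esub> \<theta> (fobj F' X))"
proof -
  note s = category_simps[OF C] category_simps[OF D] category_simps[OF E] functor_simps[OF F]
    functor_simps[OF F'] functor_simps[OF G] functor_simps[OF G'] is_nat_transD(1-3)[OF \<eta>]
    is_nat_transD(1-3)[OF \<theta>]
  show ?thesis
  proof (rule is_nat_transI)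
    fix f assume f: "f \<in> Arr C"
    let ?X = "Dom C f" and ?Y = "Cod C f"
    have "farr G (farr F f) \<Zsemi>\<^bsub>E\<^esub> (farr G (\<eta> ?Y) \<Zsemi>\<^bsub>E\<^esub> \<theta> (fobj F' ?Y))
      = farr G (farr F f \<Zsemi>\<^bsub>D\<^esub> \<eta> ?Y) \<Zsemi>\<^bsub>E\<^esub> \<theta> (fobj F' ?Y)"
      using f by (simp add: s)
    also have "\<dots> = farr G (\<eta> ?X \<Zsemi>\<^bsub>D\<^esub> farr F' f) \<Zsemi>\<^bsub>E\<^esub> \<theta> (fobj F' ?Y)"
      using f by (simp add: is_nat_transD(4)[OF \<eta>])
    \<comment> \<open>The object is written as \<open>Cod D (farr F' f)\<close> so that the square
      of \<theta> at \<open>farr F' f\<close> applies literally.\<close>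
    also have "\<dots> = farr G (\<eta> ?X) \<Zsemi>\<^bsub>E\<^esub> (farr G (farr F' f) \<Zsemi>\<^bsub>E\<^esub> \<theta> (Cod D (farr F' f)))"
      using f by (simp add: s)
    also have "\<dots> = farr G (\<eta> ?X) \<Zsemi>\<^bsub>E\<^esub> (\<theta> (Dom D (farr F' f)) \<Zsemi>\<^bsub>E\<^esub> farr G' (farr F' f))"
      using f by (subst is_nat_transD(4)[OF \<theta>]) (simp_all add: s)
    also have "\<dots> = (farr G (\<eta> ?X) \<Zsemi>\<^bsub>E\<^esub> \<theta> (fobj F' ?X)) \<Zsemi>\<^bsub>E\<^esub> farr G' (farr F' f)"
      using f by (simp add: s)
    finally show "farr (comp_functor F G) f \<Zsemi>\<^bsub>E\<^esub> (farr G (\<eta> ?Y) \<Zsemi>\<^bsub>E\<^esub> \<theta> (fobj F' ?Y))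
      = (farr G (\<eta> ?X) \<Zsemi>\<^bsub>E\<^esub> \<theta> (fobj F' ?X)) \<Zsemi>\<^bsub>E\<^esub> farr (comp_functor F' G') f"
      by simp
  qed (simp_all add: s)
qed

section \<open>Isomorphisms of categories\<close>

lemma is_cat_isoI:
  assumes "is_functor C D F" "is_functor D C G"
    and "\<And>X. X \<in> Obj C \<Longrightarrow> fobj G (fobj F X) = X" "\<And>f. f \<in> Arr C \<Longrightarrow> farr G (farr F f) = f"
    and "\<And>X. X \<in> Obj D \<Longrightarrow> fobj F (fobj G X) = X" "\<And>f. f \<in> Arr D \<Longrightarrow> farr F (farr G f) = f"
  shows "is_cat_iso C D F"
  using assms by (auto simp: is_cat_iso_def functor_eq_def intro!: exI[of _ G])

text \<open>The inverse is also delivered as an isomorphism: it becomes the witness for symmetry of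
  lens equivalence and the inverse of an iso-lens class.\<close>

lemma is_cat_isoE:
  assumes "is_cat_iso C D F"
  obtains G where "is_functor D C G"
    "\<And>X. X \<in> Obj C \<Longrightarrow> fobj G (fobj F X) = X" "\<And>f. f \<in> Arr C \<Longrightarrow> farr G (farr F f) = f"
    "\<And>X. X \<in> Obj D \<Longrightarrow> fobj F (fobj G X) = X" "\<And>f. f \<in> Arr D \<Longrightarrow> farr F (farr G f) = f"
    "is_cat_iso D C G"
proof -
  obtain G where G: "is_functor D C G" "functor_eq C (comp_functor F G) id_functor"
        "functor_eq D (comp_functor G F) id_functor"
    using assms by (auto simp: is_cat_iso_def)
  moreover have "is_cat_iso D C G"
    using assms G by (auto simp: is_cat_iso_def)
  ultimately show thesis using that[of G] by (auto simp: functor_eq_def)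
qed

lemma is_cat_iso_functor: "is_cat_iso C D F \<Longrightarrow> is_functor C D F"
  by (simp add: is_cat_iso_def)

text \<open>Cancels F on objects. The domain of a preimage under F is at first known only after F
  has been applied to it.\<close>

lemma is_cat_iso_inj:
  assumes "is_cat_iso C D F"
  shows "\<lbrakk>X \<in> Obj C; Y \<in> Obj C\<rbrakk> \<Longrightarrow> fobj F X = fobj F Y \<longleftrightarrow> X = Y"
  using assms by (metis is_cat_isoE)

text \<open>\<open>iso_lens\<close> inverts F on arrows by \<open>inv_into\<close> rather than by an
  inverse functor. Domains and codomains are therefore described through their images under
  F.\<close>

lemma is_cat_iso_inv_into:
  assumes "is_cat_iso C D F"
  shows "g \<in> Arr D \<Longrightarrow> inv_into (Arr C) (farr F) g \<in> Arr C"
    and "g \<in> Arr D \<Longrightarrow> farr F (inv_into (Arr C) (farr F) g) = g"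
    and "f \<in> Arr C \<Longrightarrow> inv_into (Arr C) (farr F) (farr F f) = f"
    and "g \<in> Arr D \<Longrightarrow> fobj F (Dom C (inv_into (Arr C) (farr F) g)) = Dom D g"
    and "g \<in> Arr D \<Longrightarrow> fobj F (Cod C (inv_into (Arr C) (farr F) g)) = Cod D g"
proof -
  obtain G where G: "is_functor D C G"
    "\<And>f. f \<in> Arr C \<Longrightarrow> farr G (farr F f) = f"
    "\<And>f. f \<in> Arr D \<Longrightarrow> farr F (farr G f) = f"
    using assms by (metis is_cat_isoE)
  note F = is_cat_iso_functor[OF assms]
  have "farr F ` Arr C = Arr D"
    using G functor_Arr[OF G(1)] functor_Arr[OF F]
    by (metis (no_types, lifting) image_eqI subsetI subset_antisym image_subset_iff)
  moreover have "inj_on (farr F) (Arr C)"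
    by (metis G(2) inj_onI)
  ultimately show *: "g \<in> Arr D \<Longrightarrow> inv_into (Arr C) (farr F) g \<in> Arr C"
    "g \<in> Arr D \<Longrightarrow> farr F (inv_into (Arr C) (farr F) g) = g"
    and "f \<in> Arr C \<Longrightarrow> inv_into (Arr C) (farr F) (farr F f) = f"
    by (auto intro: inv_into_into f_inv_into_f)
  show "g \<in> Arr D \<Longrightarrow> fobj F (Dom C (inv_into (Arr C) (farr F) g)) = Dom D g"
    "g \<in> Arr D \<Longrightarrow> fobj F (Cod C (inv_into (Arr C) (farr F) g)) = Cod D g"
    using functor_Dom[OF F *(1)] functor_Cod[OF F *(1)] *(2) by auto
qed

lemma is_cat_iso_id: "is_cat_iso C C id_functor"
  by (rule is_cat_isoI[of _ _ _ id_functor]) (simp_all add: is_functor_id)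

lemma is_cat_iso_comp:
  assumes F: "is_cat_iso C D F" and G: "is_cat_iso D E G"
  shows "is_cat_iso C E (comp_functor F G)"
proof -
  obtain F' where F': "is_functor D C F'"
    "\<And>X. X \<in> Obj C \<Longrightarrow> fobj F' (fobj F X) = X" "\<And>f. f \<in> Arr C \<Longrightarrow> farr F' (farr F f) = f"
    "\<And>X. X \<in> Obj D \<Longrightarrow> fobj F (fobj F' X) = X" "\<And>f. f \<in> Arr D \<Longrightarrow> farr F (farr F' f) = f"
    using is_cat_isoE[OF F] by metis
  obtain G' where G': "is_functor E D G'"
    "\<And>X. X \<in> Obj D \<Longrightarrow> fobj G' (fobj G X) = X" "\<And>f. f \<in> Arr D \<Longrightarrow> farr G' (farr G f) = f"
    "\<And>X. X \<in> Obj E \<Longrightarrow> fobj G (fobj G' X) = X" "\<And>f. f \<in> Arr E \<Longrightarrow> farr G (farr G' f) = f"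
    using is_cat_isoE[OF G] by metis
  note fs = is_cat_iso_functor[OF F] is_cat_iso_functor[OF G]
  show ?thesis
    by (rule is_cat_isoI[of _ _ _ "comp_functor G' F'"])
      (simp_all add: is_functor_comp[OF fs] is_functor_comp[OF G'(1) F'(1)] F' G'
        functor_simps[OF fs(1)] functor_simps[OF G'(1)])
qed

lemma is_cat_iso_prod:
  assumes F: "is_cat_iso C D F" and G: "is_cat_iso C' D' G"
  shows "is_cat_iso (prod_cat C C') (prod_cat D D') (prod_functor F G)"
proof -
  obtain F' where F': "is_functor D C F'"
    "\<And>X. X \<in> Obj C \<Longrightarrow> fobj F' (fobj F X) = X" "\<And>f. f \<in> Arr C \<Longrightarrow> farr F' (farr F f) = f"
    "\<And>X. X \<in> Obj D \<Longrightarrow> fobj F (fobj F' X) = X" "\<And>f. f \<in> Arr D \<Longrightarrow> farr F (farr F' f) = f"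
    using is_cat_isoE[OF F] by metis
  obtain G' where G': "is_functor D' C' G'"
    "\<And>X. X \<in> Obj C' \<Longrightarrow> fobj G' (fobj G X) = X" "\<And>f. f \<in> Arr C' \<Longrightarrow> farr G' (farr G f) = f"
    "\<And>X. X \<in> Obj D' \<Longrightarrow> fobj G (fobj G' X) = X" "\<And>f. f \<in> Arr D' \<Longrightarrow> farr G (farr G' f) = f"
    using is_cat_isoE[OF G] by metis
  note fs = is_cat_iso_functor[OF F] is_cat_iso_functor[OF G]
  show ?thesis
    by (rule is_cat_isoI[of _ _ _ "prod_functor F' G'"])
      (auto simp: is_functor_prod[OF fs] is_functor_prod[OF F'(1) G'(1)] F' G' elim!: psetE)
qed

section \<open>Canonical isomorphisms between products\<close>

lemma is_functor_same:
  assumes "\<And>X. X \<in> Obj C \<Longrightarrow> \<phi> X \<in> Obj D"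
    and "\<And>f. f \<in> Arr C \<Longrightarrow> \<phi> f \<in> Arr D \<and> Dom D (\<phi> f) = \<phi> (Dom C f) \<and> Cod D (\<phi> f) = \<phi> (Cod C f)"
    and "\<And>X. X \<in> Obj C \<Longrightarrow> \<phi> (Ide C X) = Ide D (\<phi> X)"
    and "\<And>f g. \<lbrakk>f \<in> Arr C; g \<in> Arr C; Cod C f = Dom C g\<rbrakk> \<Longrightarrow> \<phi> (f \<Zsemi>\<^bsub>C\<^esub> g) = \<phi> f \<Zsemi>\<^bsub>D\<^esub> \<phi> g"
  shows "is_functor C D (same_functor \<phi>)"
  using assms by (intro is_functorI) auto

lemma is_cat_iso_assoc:
  assumes "category A" "category B" "category C"
  shows "is_cat_iso (prod_cat (prod_cat A B) C) (prod_cat A (prod_cat B C)) assoc_functor"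
  unfolding assoc_functor_def
  by (rule is_cat_isoI[of _ _ _ "same_functor
    (\<lambda>x. Pr (Pr (pfst x) (pfst (psnd x))) (psnd (psnd x)))"]; (rule is_functor_same)?)
    (auto simp: category_simps[OF assms(1)] category_simps[OF assms(2)]
      category_simps[OF assms(3)] elim!: psetE)

text \<open>The inverse \<open>Pr Star\<close> serves objects and arrows alike, because the only
  object and the only arrow of \<open>one_cat\<close> are both \<open>Star\<close>.\<close>

lemma is_cat_iso_lunit: "category A \<Longrightarrow> is_cat_iso (prod_cat one_cat A) A lunit_functor"
  unfolding lunit_functor_def
  by (rule is_cat_isoI[of _ _ _ "same_functor (Pr Star)"]; (rule is_functor_same)?)
    (auto simp: category_simps elim!: psetE)

lemma is_cat_iso_runit: "category A \<Longrightarrow> is_cat_iso (prod_cat A one_cat) A runit_functor"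
  unfolding runit_functor_def
  by (rule is_cat_isoI[of _ _ _ "same_functor (\<lambda>x. Pr x Star)"]; (rule is_functor_same)?)
    (auto simp: category_simps elim!: psetE)

lemma is_cat_iso_swap:
  assumes "category A" "category B"
  shows "is_cat_iso (prod_cat A B) (prod_cat B A) swap_functor"
  unfolding swap_functor_def
  by (rule is_cat_isoI[of _ _ _ "same_functor (\<lambda>x. Pr (psnd x) (pfst x))"]; (rule is_functor_same)?)
    (auto simp: category_simps[OF assms(1)] category_simps[OF assms(2)] elim!: psetE)

text \<open>The formula is an involution on pairs of pairs, so it also gives the inverse, with B and
  C exchanged.\<close>

lemma is_cat_iso_interchange:
  assumes "category A" "category B" "category C" "category D"
  shows "is_cat_iso (prod_cat (prod_cat A B) (prod_cat C D))
    (prod_cat (prod_cat A C) (prod_cat B D))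
    (same_functor (\<lambda>x. Pr (Pr (pfst (pfst x)) (pfst (psnd x)))
      (Pr (psnd (pfst x)) (psnd (psnd x)))))"
  by (rule is_cat_isoI[of _ _ _ "same_functor
    (\<lambda>x. Pr (Pr (pfst (pfst x)) (pfst (psnd x))) (Pr (psnd (pfst x)) (psnd (psnd x))))"];
    (rule is_functor_same)?)
    (auto simp: category_simps[OF assms(1)] category_simps[OF assms(2)] category_simps[OF assms(3)]
      category_simps[OF assms(4)] elim!: psetE)

lemma (in smallness) small_category_prod_cat:
  assumes "small_category small C" "small_category small D"
  shows "small_category small (prod_cat C D)"
  using assms by (auto simp: small_category_def category_prod_cat small_pset)
    (auto simp: prod_cat_def)

lemma (in smallness) small_category_one_cat: "small_category small one_cat"
  by (auto simp: small_category_def category_one_cat small_singleton) (auto simp: one_cat_def)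

section \<open>Equivalence of lenses\<close>

lemma ala_lens_simps:
  assumes "ala_lens small l"
  shows ala_lens_small_src: "small_category small (src l)"
    and ala_lens_small_tgt: "small_category small (tgt l)"
    and ala_lens_small_params: "small_category small (params l)"
    and ala_lens_src: "category (src l)"
    and ala_lens_tgt: "category (tgt l)"
    and ala_lens_params: "category (params l)"
    and ala_lens_get: "p \<in> Obj (params l) \<Longrightarrow> is_functor (src l) (tgt l) (get l p)"
    and ala_lens_get_nt: "\<lbrakk>e \<in> Arr (params l); Dom (params l) e = p; Cod (params l) e = p'\<rbrakk>
      \<Longrightarrow> is_nat_trans (src l) (tgt l) (get l p) (get l p') (get_nt l e)"
    and ala_lens_get_nt_Ide: "\<lbrakk>p \<in> Obj (params l); A \<in> Obj (src l)\<rbrakk>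
      \<Longrightarrow> get_nt l (Ide (params l) p) A = Ide (tgt l) (fobj (get l p) A)"
    and ala_lens_get_nt_Comp: "\<lbrakk>e \<in> Arr (params l); e' \<in> Arr (params l);
        Cod (params l) e = Dom (params l) e'; A \<in> Obj (src l)\<rbrakk>
      \<Longrightarrow> get_nt l (e \<Zsemi>\<^bsub>params l\<^esub> e') A = get_nt l e A \<Zsemi>\<^bsub>tgt l\<^esub> get_nt l e' A"
  using assms by (auto simp: ala_lens_def Let_def small_category_def)

text \<open>The targets p' and A' in \<open>ala_lens\<close> are forced to be the codomains of the
  first two put arrows. Naming them so removes the existential quantifier.\<close>

lemma ala_lens_put:
  assumes "ala_lens small l" "p \<in> Obj (params l)" "A \<in> Obj (src l)" "v \<in> Arr (tgt l)"
    "Dom (tgt l) v = fobj (get l p) A"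
  shows "put_upd l p A v \<in> Arr (params l)" "Dom (params l) (put_upd l p A v) = p"
    "put_req l p A v \<in> Arr (src l)" "Dom (src l) (put_req l p A v) = A"
    "put_self l p A v \<in> Arr (tgt l)" "Dom (tgt l) (put_self l p A v) = Cod (tgt l) v"
    "Cod (tgt l) (put_self l p A v)
      = fobj (get l (Cod (params l) (put_upd l p A v))) (Cod (src l) (put_req l p A v))"
  using assms by (auto simp: ala_lens_def Let_def put_dom_def hom_def)

lemma ala_lens_get_simps:
  assumes "ala_lens small l" "p \<in> Obj (params l)"
  shows "X \<in> Obj (src l) \<Longrightarrow> fobj (get l p) X \<in> Obj (tgt l)"
    and "f \<in> Arr (src l) \<Longrightarrow> farr (get l p) f \<in> Arr (tgt l)"
    and "f \<in> Arr (src l) \<Longrightarrow> Dom (tgt l) (farr (get l p) f) = fobj (get l p) (Dom (src l) f)"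
    and "f \<in> Arr (src l) \<Longrightarrow> Cod (tgt l) (farr (get l p) f) = fobj (get l p) (Cod (src l) f)"
    and "X \<in> Obj (src l) \<Longrightarrow> farr (get l p) (Ide (src l) X) = Ide (tgt l) (fobj (get l p) X)"
    and "\<lbrakk>f \<in> Arr (src l); g \<in> Arr (src l); Cod (src l) f = Dom (src l) g\<rbrakk>
      \<Longrightarrow> farr (get l p) (f \<Zsemi>\<^bsub>src l\<^esub> g) = farr (get l p) f \<Zsemi>\<^bsub>tgt l\<^esub> farr (get l p) g"
  using functor_simps[OF ala_lens_get[OF assms]] by auto

lemma ala_lens_get_nt_simps:
  assumes "ala_lens small l" "e \<in> Arr (params l)" "A \<in> Obj (src l)"
  shows "get_nt l e A \<in> Arr (tgt l)"
    and "Dom (tgt l) (get_nt l e A) = fobj (get l (Dom (params l) e)) A"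
    and "Cod (tgt l) (get_nt l e A) = fobj (get l (Cod (params l) e)) A"
  using is_nat_transD[OF ala_lens_get_nt[OF assms(1,2) refl refl]] assms(3) by auto

lemma ala_lens_get_nt_natural:
  assumes "ala_lens small l" "e \<in> Arr (params l)" "f \<in> Arr (src l)"
  shows "farr (get l (Dom (params l) e)) f \<Zsemi>\<^bsub>tgt l\<^esub> get_nt l e (Cod (src l) f)
    = get_nt l e (Dom (src l) f) \<Zsemi>\<^bsub>tgt l\<^esub> farr (get l (Cod (params l) e)) f"
  using is_nat_transD[OF ala_lens_get_nt[OF assms(1,2) refl refl]] assms(3) by auto

lemmas lens_facts = ala_lens_simps ala_lens_put ala_lens_get_simps ala_lens_get_nt_simps

lemma ala_lensI:
  assumes "small_category small (src l)" "small_category small (tgt l)"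
    "small_category small (params l)"
    and "\<And>p. p \<in> Obj (params l) \<Longrightarrow> is_functor (src l) (tgt l) (get l p)"
    and "\<And>e. e \<in> Arr (params l) \<Longrightarrow> is_nat_trans (src l) (tgt l)
      (get l (Dom (params l) e)) (get l (Cod (params l) e)) (get_nt l e)"
    and "\<And>p A. \<lbrakk>p \<in> Obj (params l); A \<in> Obj (src l)\<rbrakk>
      \<Longrightarrow> get_nt l (Ide (params l) p) A = Ide (tgt l) (fobj (get l p) A)"
    and "\<And>e e' A. \<lbrakk>e \<in> Arr (params l); e' \<in> Arr (params l);
        Cod (params l) e = Dom (params l) e'; A \<in> Obj (src l)\<rbrakk>
      \<Longrightarrow> get_nt l (e \<Zsemi>\<^bsub>params l\<^esub> e') A = get_nt l e A \<Zsemi>\<^bsub>tgt l\<^esub> get_nt l e' A"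
    and "\<And>p A v. \<lbrakk>p \<in> Obj (params l); A \<in> Obj (src l); v \<in> Arr (tgt l);
        Dom (tgt l) v = fobj (get l p) A\<rbrakk>
      \<Longrightarrow> put_upd l p A v \<in> Arr (params l) \<and> Dom (params l) (put_upd l p A v) = p
        \<and> put_req l p A v \<in> Arr (src l) \<and> Dom (src l) (put_req l p A v) = A
        \<and> put_self l p A v \<in> Arr (tgt l) \<and> Dom (tgt l) (put_self l p A v) = Cod (tgt l) v
        \<and> Cod (tgt l) (put_self l p A v)
          = fobj (get l (Cod (params l) (put_upd l p A v))) (Cod (src l) (put_req l p A v))"
  shows "ala_lens small l"
  using assms by (auto simp: ala_lens_def Let_def put_dom_def hom_def)

text \<open>Lens equivalence with its witness \<alpha> exposed, so that witnesses can be composed,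
  inverted and paired explicitly.\<close>

definition lens_iso :: "'a ufun \<Rightarrow> 'a lens \<Rightarrow> 'a lens \<Rightarrow> bool" where
  "lens_iso \<alpha> k l \<longleftrightarrow> src k = src l \<and> tgt k = tgt l \<and> is_cat_iso (params k) (params l) \<alpha> \<and>
     (\<forall>p \<in> Obj (params k). functor_eq (src k) (get k p) (get l (fobj \<alpha> p))) \<and>
     (\<forall>e \<in> Arr (params k). \<forall>A \<in> Obj (src k). get_nt k e A = get_nt l (farr \<alpha> e) A) \<and>
     (\<forall>(p, A, v) \<in> put_dom k.
        farr \<alpha> (put_upd k p A v) = put_upd l (fobj \<alpha> p) A v \<and>
        put_req k p A v = put_req l (fobj \<alpha> p) A v \<and>
        put_self k p A v = put_self l (fobj \<alpha> p) A v)"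

lemma lens_equivalent_iff_lens_iso: "lens_equivalent k l \<longleftrightarrow> (\<exists>\<alpha>. lens_iso \<alpha> k l)"
  by (simp add: lens_equivalent_def lens_iso_def)

lemma lens_isoI:
  assumes "src k = src l" "tgt k = tgt l" "is_cat_iso (params k) (params l) \<alpha>"
    and "\<And>p X. \<lbrakk>p \<in> Obj (params k); X \<in> Obj (src k)\<rbrakk> \<Longrightarrow> fobj (get k p) X = fobj (get l (fobj \<alpha> p)) X"
    and "\<And>p f. \<lbrakk>p \<in> Obj (params k); f \<in> Arr (src k)\<rbrakk> \<Longrightarrow> farr (get k p) f = farr (get l (fobj \<alpha> p)) f"
    and "\<And>e A. \<lbrakk>e \<in> Arr (params k); A \<in> Obj (src k)\<rbrakk> \<Longrightarrow> get_nt k e A = get_nt l (farr \<alpha> e) A"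
    and "\<And>p A v. \<lbrakk>p \<in> Obj (params k); A \<in> Obj (src k); v \<in> Arr (tgt k);
        Dom (tgt k) v = fobj (get k p) A\<rbrakk>
      \<Longrightarrow> farr \<alpha> (put_upd k p A v) = put_upd l (fobj \<alpha> p) A v
        \<and> put_req k p A v = put_req l (fobj \<alpha> p) A v
        \<and> put_self k p A v = put_self l (fobj \<alpha> p) A v"
  shows "lens_iso \<alpha> k l"
  unfolding lens_iso_def put_dom_def functor_eq_def using assms by blast

lemma lens_iso_cong:
  assumes "lens_iso \<alpha> k l"
  shows lens_iso_src: "src k = src l"
    and lens_iso_tgt: "tgt k = tgt l"
    and lens_iso_params: "is_cat_iso (params k) (params l) \<alpha>"
    and lens_iso_fobj: "\<lbrakk>p \<in> Obj (params k); X \<in> Obj (src k)\<rbrakk>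
      \<Longrightarrow> fobj (get k p) X = fobj (get l (fobj \<alpha> p)) X"
    and lens_iso_farr: "\<lbrakk>p \<in> Obj (params k); f \<in> Arr (src k)\<rbrakk>
      \<Longrightarrow> farr (get k p) f = farr (get l (fobj \<alpha> p)) f"
    and lens_iso_get_nt: "\<lbrakk>e \<in> Arr (params k); X \<in> Obj (src k)\<rbrakk>
      \<Longrightarrow> get_nt k e X = get_nt l (farr \<alpha> e) X"
    and lens_iso_upd: "\<lbrakk>p \<in> Obj (params k); X \<in> Obj (src k); v \<in> Arr (tgt k);
        Dom (tgt k) v = fobj (get k p) X\<rbrakk> \<Longrightarrow> farr \<alpha> (put_upd k p X v) = put_upd l (fobj \<alpha> p) X v"
    and lens_iso_req: "\<lbrakk>p \<in> Obj (params k); X \<in> Obj (src k); v \<in> Arr (tgt k);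
        Dom (tgt k) v = fobj (get k p) X\<rbrakk> \<Longrightarrow> put_req k p X v = put_req l (fobj \<alpha> p) X v"
    and lens_iso_self: "\<lbrakk>p \<in> Obj (params k); X \<in> Obj (src k); v \<in> Arr (tgt k);
        Dom (tgt k) v = fobj (get k p) X\<rbrakk> \<Longrightarrow> put_self k p X v = put_self l (fobj \<alpha> p) X v"
  using assms unfolding lens_iso_def put_dom_def functor_eq_def by blast+

lemma lens_iso_refl: "lens_iso id_functor k k"
  by (rule lens_isoI) (simp_all add: is_cat_iso_id)

text \<open>Inverting the clause on \<open>put_upd\<close> cancels \<alpha> on
  \<open>put_upd k\<close>. This needs \<open>put_upd k\<close> to be an arrow of the parameter
  category, which is where the lens laws of k enter.\<close>

lemma lens_equivalent_sym:
  assumes k: "ala_lens small k" and "lens_equivalent k l"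
  shows "lens_equivalent l k"
proof -
  obtain \<alpha> where \<alpha>: "lens_iso \<alpha> k l"
    using assms(2) by (auto simp: lens_equivalent_iff_lens_iso)
  note c = lens_iso_cong[OF \<alpha>]
  obtain \<beta> where \<beta>: "is_functor (params l) (params k) \<beta>"
    "\<And>X. X \<in> Obj (params k) \<Longrightarrow> fobj \<beta> (fobj \<alpha> X) = X"
      "\<And>f. f \<in> Arr (params k) \<Longrightarrow> farr \<beta> (farr \<alpha> f) = f"
    "\<And>X. X \<in> Obj (params l) \<Longrightarrow> fobj \<alpha> (fobj \<beta> X) = X"
      "\<And>f. f \<in> Arr (params l) \<Longrightarrow> farr \<alpha> (farr \<beta> f) = f"
    and iso: "is_cat_iso (params l) (params k) \<beta>"
    using is_cat_isoE[OF c(3)] by metis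
  note b = functor_simps(1,2)[OF \<beta>(1)]
  \<comment> \<open>Agreement on objects comes first, because it decides which updates v are
    admissible put arguments for k and for l.\<close>
  have get: "fobj (get k (fobj \<beta> p)) X = fobj (get l p) X"
    if "p \<in> Obj (params l)" "X \<in> Obj (src l)" for p X
    using that c(4)[of "fobj \<beta> p" X] by (simp add: c(1) b \<beta>(4))
  have "lens_iso \<beta> l k"
  proof (rule lens_isoI)
    fix p A v
    assume p: "p \<in> Obj (params l)" "A \<in> Obj (src l)" "v \<in> Arr (tgt l)"
      "Dom (tgt l) v = fobj (get l p) A"
    then have p': "fobj \<beta> p \<in> Obj (params k)" "A \<in> Obj (src k)" "v \<in> Arr (tgt k)"
      "Dom (tgt k) v = fobj (get k (fobj \<beta> p)) A"
      by (simp_all add: c(1,2) b get)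
    show "farr \<beta> (put_upd l p A v) = put_upd k (fobj \<beta> p) A v \<and>
      put_req l p A v = put_req k (fobj \<beta> p) A v \<and> put_self l p A v = put_self k (fobj \<beta> p) A v"
      using c(7-9)[OF p'] \<beta>(3)[OF ala_lens_put(1)[OF k p']] by (simp add: \<beta>(4) p(1))
  next
    fix p f assume p: "p \<in> Obj (params l)" "f \<in> Arr (src l)"
    then show "farr (get l p) f = farr (get k (fobj \<beta> p)) f"
      using c(5)[of "fobj \<beta> p" f] by (simp add: c(1) b \<beta>(4))
  next
    fix e A assume "e \<in> Arr (params l)" "A \<in> Obj (src l)"
    then show "get_nt l e A = get_nt k (farr \<beta> e) A"
      using c(6)[of "farr \<beta> e" A] by (simp add: c(1) b \<beta>(5))
  qed (simp_all add: c(1,2) iso get)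
  then show ?thesis
    by (auto simp: lens_equivalent_iff_lens_iso)
qed

lemma lens_iso_trans:
  assumes \<alpha>: "lens_iso \<alpha> k l" and \<beta>: "lens_iso \<beta> l m"
  shows "lens_iso (comp_functor \<alpha> \<beta>) k m"
proof -
  note c = lens_iso_cong[OF \<alpha>] and d = lens_iso_cong[OF \<beta>]
  note f = functor_simps(1,2)[OF is_cat_iso_functor[OF c(3)]]
  show ?thesis
  proof (rule lens_isoI)
    fix p A v
    assume p: "p \<in> Obj (params k)" "A \<in> Obj (src k)" "v \<in> Arr (tgt k)"
      "Dom (tgt k) v = fobj (get k p) A"
    then have p': "fobj \<alpha> p \<in> Obj (params l)" "A \<in> Obj (src l)" "v \<in> Arr (tgt l)"
      "Dom (tgt l) v = fobj (get l (fobj \<alpha> p)) A"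
      by (simp_all add: c(1,2) f c(4)[symmetric])
    show "farr (comp_functor \<alpha> \<beta>) (put_upd k p A v) = put_upd m (fobj (comp_functor \<alpha> \<beta>) p) A v \<and>
      put_req k p A v = put_req m (fobj (comp_functor \<alpha> \<beta>) p) A v \<and>
      put_self k p A v = put_self m (fobj (comp_functor \<alpha> \<beta>) p) A v"
      using c(7-9)[OF p] d(7-9)[OF p'] by simp
  qed (use c d f in \<open>auto intro: is_cat_iso_comp\<close>)
qed

lemma equiv_lens_eq: "equiv {l. ala_lens small l} (lens_eq small)"
proof (rule equivI)
  show "lens_eq small \<subseteq> {l. ala_lens small l} \<times> {l. ala_lens small l}"
    by (auto simp: lens_eq_def)
  show "refl_on {l. ala_lens small l} (lens_eq small)"
    unfolding refl_on_def lens_eq_def lens_equivalent_iff_lens_iso using lens_iso_refl by blast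
  show "sym (lens_eq small)"
    unfolding sym_on_def lens_eq_def using lens_equivalent_sym by blast
  show "trans (lens_eq small)"
    unfolding trans_on_def lens_eq_def lens_equivalent_iff_lens_iso using lens_iso_trans by blast
qed

section \<open>Operations on lenses\<close>

context smallness
begin

section \<open>Iso-lenses and identity lenses\<close>

lemma iso_lens_sel [simp]:
  "src (iso_lens A B F) = A" "tgt (iso_lens A B F) = B" "params (iso_lens A B F) = one_cat"
  "get (iso_lens A B F) p = F" "get_nt (iso_lens A B F) e X = Ide B (fobj F X)"
  "put_upd (iso_lens A B F) p X v = Star"
  "put_req (iso_lens A B F) p X v = inv_into (Arr A) (farr F) v"
  "put_self (iso_lens A B F) p X v = Ide B (Cod B v)"
  by (simp_all add: iso_lens_def)

lemma id_lens_sel [simp]: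
  "src (id_lens A) = A" "tgt (id_lens A) = A" "params (id_lens A) = one_cat"
  "get (id_lens A) p = id_functor" "get_nt (id_lens A) e X = Ide A X"
  "put_upd (id_lens A) p X v = Star" "put_req (id_lens A) p X v = v"
  "put_self (id_lens A) p X v = Ide A (Cod A v)"
  by (simp_all add: id_lens_def)

text \<open>Lets identities enter the coherence laws as iso-lenses. \<open>inv_into\<close> along
  the identity functor returns v only for arrows v of A, so the two lenses are compared by
  equivalence, not as records.\<close>

lemma id_lens_iso_lens:
  fixes A :: "'a ucat"
  shows "lens_iso id_functor (id_lens A) (iso_lens A A id_functor)"
proof (rule lens_isoI)
  fix p X v assume "v \<in> Arr (tgt (id_lens A))"
  then have "inv_into (Arr A) (farr (id_functor :: 'a ufun)) v = v"
    using is_cat_iso_inv_into(3)[OF is_cat_iso_id, of v A] by (simp add: id_lens_def)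
  then show "farr id_functor (put_upd (id_lens A) p X v)
    = put_upd (iso_lens A A id_functor) (fobj id_functor p) X v \<and>
    put_req (id_lens A) p X v = put_req (iso_lens A A id_functor) (fobj id_functor p) X v \<and>
    put_self (id_lens A) p X v = put_self (iso_lens A A id_functor) (fobj id_functor p) X v"
    by (simp add: id_lens_def iso_lens_def)
qed (simp_all add: id_lens_def iso_lens_def is_cat_iso_id)

lemma small_category_category: "small_category small A \<Longrightarrow> category A"
  by (simp add: small_category_def)

lemma ala_lens_iso:
  assumes "small_category small A" "small_category small B" "is_cat_iso A B F"
  shows "ala_lens small (iso_lens A B F)"
proof -
  note fs = is_cat_iso_functor[OF assms(3)]
  note s = small_category_category[OF assms(1)] small_category_category[OF assms(2)]
  note s' = functor_simps[OF fs] category_simps[OF s(1)] category_simps[OF s(2)]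
    is_cat_iso_inv_into[OF assms(3)]
  \<comment> \<open>The requested update must start at X; applying F reduces this to the assumption
    on the domain of v.\<close>
  have "Dom A (inv_into (Arr A) (farr F) v) = X" if "v \<in> Arr B" "Dom B v = fobj F X" "X \<in> Obj A"
    for v X
    using that is_cat_iso_inj[OF assms(3), of "Dom A (inv_into (Arr A) (farr F) v)" X]
    by (simp add: s')
  then show ?thesis
    by (intro ala_lensI is_nat_transI)
      (simp_all add: small_category_one_cat assms fs s')
qed

lemma ala_lens_id:
  assumes "small_category small A"
  shows "ala_lens small (id_lens A)"
proof -
  note s = small_category_category[OF assms]
  show ?thesis
    by (intro ala_lensI is_nat_transI)
      (simp_all add: id_lens_def small_category_one_cat assms is_functor_id category_simps[OF s])
qed

section \<open>Closure of lenses under parallel and sequential composition\<close>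

lemma ala_lens_par:
  assumes "ala_lens small k" "ala_lens small l"
  shows "ala_lens small (par_lens k l)"
  by (intro ala_lensI is_nat_transI)
    (auto simp: par_lens_def small_category_prod_cat lens_facts[OF assms(1)]
      lens_facts[OF assms(2)] is_functor_prod
      ala_lens_get_nt_natural[OF assms(1)] ala_lens_get_nt_natural[OF assms(2)]
      category_simps[OF ala_lens_params[OF assms(1)]]
        category_simps[OF ala_lens_params[OF assms(2)]]
      category_simps[OF ala_lens_src[OF assms(1)]] category_simps[OF ala_lens_src[OF assms(2)]]
      elim!: psetE)

text \<open>Stated on pairs, since every parameter of a product category is one; the projections and
  local abbreviations of the definition then disappear.\<close>

lemma seq_lens_sel:
  "src (seq_lens k l) = src k" "tgt (seq_lens k l) = tgt l"
  "params (seq_lens k l) = prod_cat (params k) (params l)"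
  "get (seq_lens k l) (Pr p q) = comp_functor (get k p) (get l q)"
  "get_nt (seq_lens k l) (Pr e h) A = farr (get l (Dom (params l) h)) (get_nt k e A)
     \<Zsemi>\<^bsub>tgt l\<^esub> get_nt l h (fobj (get k (Cod (params k) e)) A)"
  "put_upd (seq_lens k l) (Pr p q) A w
    = Pr (put_upd k p A (put_req l q (fobj (get k p) A) w)) (put_upd l q (fobj (get k p) A) w)"
  "put_req (seq_lens k l) (Pr p q) A w = put_req k p A (put_req l q (fobj (get k p) A) w)"
  "put_self (seq_lens k l) (Pr p q) A w = put_self l q (fobj (get k p) A) w \<Zsemi>\<^bsub>tgt l\<^esub>
    farr (get l (Cod (params l) (put_upd l q (fobj (get k p) A) w)))
      (put_self k p A (put_req l q (fobj (get k p) A) w))"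
  by (simp_all add: seq_lens_def Let_def)

lemma par_lens_sel:
  "src (par_lens k l) = prod_cat (src k) (src l)" "tgt (par_lens k l) = prod_cat (tgt k) (tgt l)"
  "params (par_lens k l) = prod_cat (params k) (params l)"
  "get (par_lens k l) (Pr p q) = prod_functor (get k p) (get l q)"
  "get_nt (par_lens k l) (Pr e h) (Pr A B) = Pr (get_nt k e A) (get_nt l h B)"
  "put_upd (par_lens k l) (Pr p q) (Pr A B) (Pr v w) = Pr (put_upd k p A v) (put_upd l q B w)"
  "put_req (par_lens k l) (Pr p q) (Pr A B) (Pr v w) = Pr (put_req k p A v) (put_req l q B w)"
  "put_self (par_lens k l) (Pr p q) (Pr A B) (Pr v w) = Pr (put_self k p A v) (put_self l q B w)"
  by (simp_all add: par_lens_def)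

text \<open>Functoriality of the composite \<open>get\<close> is the interchange law for horizontal
  composites. The put law holds because the update requested by l starts at
  \<open>fobj (get k p) A\<close> and is thus an admissible argument for k.\<close>

lemma ala_lens_seq:
  assumes k: "ala_lens small k" and l: "ala_lens small l" and kl: "tgt k = src l"
  shows "ala_lens small (seq_lens k l)"
proof -
  note cat = category_simps[OF ala_lens_params[OF k]] category_simps[OF ala_lens_params[OF l]]
    category_simps[OF ala_lens_src[OF k]] category_simps[OF ala_lens_src[OF l]]
    category_simps[OF ala_lens_tgt[OF l]]
  note s = cat lens_facts[OF k, unfolded kl] lens_facts[OF l]
  have nat: "is_nat_trans (src k) (tgt l) (comp_functor (get k p) (get l q))
    (comp_functor (get k p') (get l q'))
    (get_nt (seq_lens k l) (Pr e h))"
    if "e \<in> Arr (params k)" "h \<in> Arr (params l)" "Dom (params k) e = p" "Dom (params l) h = q"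
       "Cod (params k) e = p'" "Cod (params l) h = q'" for e h p q p' q'
    unfolding seq_lens_sel that(4,5)
    by (rule is_nat_trans_hcomp[where D = "src l"]) (use that in \<open>auto intro!: s simp: s\<close>)
  have comp: "get_nt (seq_lens k l) (Pr (e \<Zsemi>\<^bsub>params k\<^esub> e') (h \<Zsemi>\<^bsub>params l\<^esub> h')) A =
    get_nt (seq_lens k l) (Pr e h) A \<Zsemi>\<^bsub>tgt l\<^esub> get_nt (seq_lens k l) (Pr e' h') A"
    if "e \<in> Arr (params k)" "e' \<in> Arr (params k)" "Cod (params k) e = Dom (params k) e'"
      "h \<in> Arr (params l)" "h' \<in> Arr (params l)" "Cod (params l) h = Dom (params l) h'"
        "A \<in> Obj (src k)"
    for e e' h h' A
  proof -
    let ?q = "Dom (params l) h" and ?q' = "Dom (params l) h'"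
    let ?B = "fobj (get k (Dom (params k) e')) A" and ?B' = "fobj (get k (Cod (params k) e')) A"
    let ?e = "get_nt k e A" and ?e' = "get_nt k e' A"
    \<comment> \<open>The heart of the interchange law: the two middle factors are exchanged by
      naturality of \<open>get_nt l h\<close> at the component \<open>?e'\<close>.\<close>
    have nat: "farr (get l ?q) ?e' \<Zsemi>\<^bsub>tgt l\<^esub> get_nt l h ?B'
      = get_nt l h ?B \<Zsemi>\<^bsub>tgt l\<^esub> farr (get l ?q') ?e'"
      using ala_lens_get_nt_natural[OF l that(4), of ?e'] that by (simp add: s)
    have "get_nt (seq_lens k l) (Pr (e \<Zsemi>\<^bsub>params k\<^esub> e') (h \<Zsemi>\<^bsub>params l\<^esub> h')) A
      = farr (get l ?q) ?e \<Zsemi>\<^bsub>tgt l\<^esub> ((farr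
        (get l ?q) ?e' \<Zsemi>\<^bsub>tgt l\<^esub> get_nt l h ?B') \<Zsemi>\<^bsub>tgt l\<^esub> get_nt l h' ?B')"
      using that by (simp add: seq_lens_sel s)
    also have "\<dots> = get_nt (seq_lens k l) (Pr e h) A \<Zsemi>\<^bsub>tgt l\<^esub> get_nt (seq_lens k l) (Pr e' h') A"
      unfolding nat using that by (simp add: seq_lens_sel s)
    finally show ?thesis .
  qed
  let ?m = "seq_lens k l"
  show ?thesis
  proof (rule ala_lensI)
    show "is_nat_trans (src ?m) (tgt ?m) (get ?m (Dom (params ?m) e)) (get ?m (Cod (params ?m) e))
      (get_nt ?m e)"
      if "e \<in> Arr (params ?m)" for e
      using that by (auto simp: seq_lens_sel(1-4) nat elim!: psetE)
    show "get_nt ?m (e \<Zsemi>\<^bsub>params ?m\<^esub> e') A = get_nt ?m e A \<Zsemi>\<^bsub>tgt ?m\<^esub> get_nt ?m e' A"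
      if "e \<in> Arr (params ?m)" "e' \<in> Arr (params ?m)" "Cod (params ?m) e = Dom (params ?m) e'"
        "A \<in> Obj (src ?m)" for e e' A
      using that by (auto simp: seq_lens_sel(1-4) comp elim!: psetE)
    show "is_functor (src ?m) (tgt ?m) (get ?m p)" if "p \<in> Obj (params ?m)" for p
      using that by (auto simp: seq_lens_sel s elim!: psetE
        intro!: is_functor_comp[where D = "src l"])
  qed (auto simp: seq_lens_sel small_category_prod_cat s elim!: psetE)
qed

section \<open>Congruence, associativity and interchange\<close>

lemma lens_iso_par:
  assumes \<alpha>: "lens_iso \<alpha> k k'" and \<beta>: "lens_iso \<beta> l l'"
  shows "lens_iso (prod_functor \<alpha> \<beta>) (par_lens k l) (par_lens k' l')"
  by (rule lens_isoI)
    (use lens_iso_cong[OF \<alpha>] lens_iso_cong[OF \<beta>] in \<open>auto simp: par_lens_sel is_cat_iso_prod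
      elim!: psetE\<close>)

text \<open>The puts are nested, so the inner arguments have to be matched first: agreement of
  \<open>get\<close> gives the same middle object, and agreement of \<open>put_req\<close> for l and
  l' the same update for k and k'.\<close>

lemma lens_iso_seq:
  assumes k: "ala_lens small k" and l: "ala_lens small l" and kl: "tgt k = src l"
    and \<alpha>: "lens_iso \<alpha> k k'" and \<beta>: "lens_iso \<beta> l l'"
  shows "lens_iso (prod_functor \<alpha> \<beta>) (seq_lens k l) (seq_lens k' l')"
proof -
  note a = lens_iso_cong[OF \<alpha>] and b = lens_iso_cong[OF \<beta>]
  note f = functor_simps[OF is_cat_iso_functor[OF a(3)]]
    functor_simps[OF is_cat_iso_functor[OF b(3)]]
  note s = f lens_facts[OF k, unfolded kl] lens_facts[OF l]
    category_simps[OF ala_lens_params[OF k]] category_simps[OF ala_lens_params[OF l]]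
    category_simps[OF ala_lens_src[OF k]]
  let ?m = "seq_lens k l" and ?m' = "seq_lens k' l'" and ?\<gamma> = "prod_functor \<alpha> \<beta>"
  show ?thesis
  proof (rule lens_isoI)
    show "get_nt ?m e A = get_nt ?m' (farr ?\<gamma> e) A"
      if "e \<in> Arr (params ?m)" "A \<in> Obj (src ?m)" for e A
      using that by (auto simp: seq_lens_sel s a(4,6)[symmetric] b(2,5,6)[symmetric] elim!: psetE)
  next
    fix r A w
    assume "r \<in> Obj (params ?m)" "A \<in> Obj (src ?m)" "w \<in> Arr (tgt ?m)"
      "Dom (tgt ?m) w = fobj (get ?m r) A"
    then obtain p q where r: "r = Pr p q" and pq: "p \<in> Obj (params k)" "q \<in> Obj (params l)"
      and A: "A \<in> Obj (src k)" and w: "w \<in> Arr (tgt l)"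
        "Dom (tgt l) w = fobj (get l q) (fobj (get k p) A)"
      by (auto simp: seq_lens_sel elim!: psetE)
    let ?B = "fobj (get k p) A"
    let ?v = "put_req l q ?B w"
    have B: "?B \<in> Obj (src l)" "fobj (get k' (fobj \<alpha> p)) A = ?B"
      using pq A by (simp_all add: s a(4)[symmetric])
    note b' = b(7-9)[OF pq(2) B(1) w]
    have v: "?v \<in> Arr (tgt k)" "Dom (tgt k) ?v = ?B"
      using pq B w by (simp_all add: s kl)
    note a' = a(7-9)[OF pq(1) A v]
    \<comment> \<open>The composite \<open>put_self\<close> applies \<open>get\<close> at the
      updated parameter of the second lens, so \<beta> must relate the updated parameters as
      well.\<close>
    have "Cod (params l') (farr \<beta> (put_upd l q ?B w)) = fobj \<beta> (Cod (params l) (put_upd l q ?B w))"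
      using pq B w by (simp add: s)
    then show "farr ?\<gamma> (put_upd ?m r A w) = put_upd ?m' (fobj ?\<gamma> r) A w \<and>
      put_req ?m r A w = put_req ?m' (fobj ?\<gamma> r) A w \<and> put_self ?m r A w
        = put_self ?m' (fobj ?\<gamma> r) A w"
      using pq A w v B
      by (simp add: r seq_lens_sel B(2) b'[symmetric] a'[symmetric] b(2,5)[symmetric] s)
  qed (auto simp: seq_lens_sel a(1) b(2) a(4,5)[symmetric] b(4,5)[symmetric] is_cat_iso_prod a(3)
    b(3) s elim!: psetE)
qed

text \<open>Both bracketings pass the same updates through the three lenses. The components of
  \<open>get_nt\<close> and the \<open>put_self\<close> arrows agree by functoriality of
  \<open>get m\<close> and associativity in the target of m.\<close>

lemma lens_iso_seq_assoc:
  assumes k: "ala_lens small k" and l: "ala_lens small l" and m: "ala_lens small m"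
    and kl: "tgt k = src l" and lm: "tgt l = src m"
  shows "lens_iso assoc_functor (seq_lens (seq_lens k l) m) (seq_lens k (seq_lens l m))"
proof -
  note s = lens_facts[OF k, unfolded kl] lens_facts[OF l, unfolded lm] lens_facts[OF m]
    category_simps[OF ala_lens_params[OF k]] category_simps[OF ala_lens_params[OF l]]
    category_simps[OF ala_lens_params[OF m]] category_simps[OF ala_lens_src[OF k]]
    category_simps[OF ala_lens_src[OF l]] category_simps[OF ala_lens_src[OF m]]
    category_simps[OF ala_lens_tgt[OF m]]
  show ?thesis
    by (rule lens_isoI)
      (auto simp: seq_lens_sel lm is_cat_iso_assoc s elim!: psetE, auto
        simp: assoc_functor_def seq_lens_sel s lm)
qed

text \<open>Composition in \<open>prod_cat\<close> is componentwise, so the two lenses differ only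
  in the order of their four parameter factors.\<close>

lemma lens_iso_interchange:
  assumes k: "ala_lens small k" and l: "ala_lens small l" and k': "ala_lens small k'"
    and l': "ala_lens small l'"
    and kl: "tgt k = src l" "tgt k' = src l'"
  shows "\<exists>\<alpha>. lens_iso \<alpha> (par_lens (seq_lens k l) (seq_lens k' l'))
    (seq_lens (par_lens k k') (par_lens l l'))"
proof -
  note s = lens_facts[OF k, unfolded kl] lens_facts[OF l] lens_facts[OF k', unfolded kl]
    lens_facts[OF l']
    category_simps[OF ala_lens_params[OF k]] category_simps[OF ala_lens_params[OF l]]
    category_simps[OF ala_lens_params[OF k']] category_simps[OF ala_lens_params[OF l']]
    category_simps[OF ala_lens_src[OF k]] category_simps[OF ala_lens_src[OF l]]
    category_simps[OF ala_lens_src[OF k']] category_simps[OF ala_lens_src[OF l']]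
  show ?thesis
    by (intro exI, rule lens_isoI[where \<alpha>
      = "same_functor (\<lambda>x. Pr (Pr (pfst (pfst x)) (pfst (psnd x)))
        (Pr (psnd (pfst x)) (psnd (psnd x))))"])
      (auto simp: seq_lens_sel par_lens_sel is_cat_iso_interchange s elim!: psetE)
qed

section \<open>Compatibility of iso-lenses with composition and products\<close>

lemma inv_into_comp_functor:
  assumes F: "is_cat_iso C D F" and G: "is_cat_iso D E G" and w: "w \<in> Arr E"
  shows "inv_into (Arr C) (farr (comp_functor F G)) w
    = inv_into (Arr C) (farr F) (inv_into (Arr D) (farr G) w)"
  \<comment> \<open>The right-hand side is a preimage of w under the composite. Cancelling the
    composite on it avoids comparing two choices.\<close>
  using is_cat_iso_inv_into(3)[OF is_cat_iso_comp[OF F G], of "inv_into (Arr C) (farr F)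
    (inv_into (Arr D) (farr G) w)"] w
  by (simp add: is_cat_iso_inv_into[OF F] is_cat_iso_inv_into[OF G])

lemma inv_into_prod_functor:
  assumes F: "is_cat_iso C D F" and G: "is_cat_iso C' D' G" and w: "v \<in> Arr D" "w \<in> Arr D'"
  shows "inv_into (pset (Arr C) (Arr C')) (farr (prod_functor F G)) (Pr v w)
    = Pr (inv_into (Arr C) (farr F) v) (inv_into (Arr C') (farr G) w)"
  using is_cat_iso_inv_into(3)[OF is_cat_iso_prod[OF F G], of "Pr (inv_into (Arr C) (farr F) v)
    (inv_into (Arr C') (farr G) w)"] w
  by (simp add: is_cat_iso_inv_into[OF F] is_cat_iso_inv_into[OF G])

text \<open>The choice made by \<open>inv_into (Arr A)\<close> depends only on values on
  \<open>Arr A\<close>, so pointwise agreement on A determines the iso-lens up to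
  equivalence.\<close>

lemma lens_iso_iso_lens_cong:
  assumes "functor_eq A F G"
  shows "lens_iso id_functor (iso_lens A B F) (iso_lens A B G)"
proof -
  have "inv_into (Arr A) (farr F) v = inv_into (Arr A) (farr G) v" for v
    using assms by (auto simp: inv_into_def functor_eq_def intro!: arg_cong[where f = Eps])
  then show ?thesis
    using assms by (intro lens_isoI) (auto simp: is_cat_iso_id functor_eq_def)
qed

text \<open>The composite has parameters 1 x 1, and the left unitor is an isomorphism from there to
  1. Its \<open>put_self\<close> arrows reduce to composites of identities.\<close>

lemma lens_iso_seq_iso_lens:
  assumes "category B" "category C" "is_cat_iso A B F" "is_cat_iso B C G"
  shows "lens_iso lunit_functor (seq_lens (iso_lens A B F) (iso_lens B C G))
    (iso_lens A C (comp_functor F G))"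
  using assms
  by (intro lens_isoI)
    (auto simp: seq_lens_sel is_cat_iso_lunit[unfolded lunit_functor_def] category_one_cat
      functor_simps[OF is_cat_iso_functor] category_simps
      inv_into_comp_functor is_cat_iso_inv_into lunit_functor_def elim!: psetE)

lemma lens_iso_par_iso_lens:
  assumes "category B" "category B'" "is_cat_iso A B F" "is_cat_iso A' B' G"
  shows "lens_iso lunit_functor (par_lens (iso_lens A B F) (iso_lens A' B' G))
    (iso_lens (prod_cat A A') (prod_cat B B') (prod_functor F G))"
  using assms
  by (intro lens_isoI)
    (auto simp: par_lens_sel is_cat_iso_lunit[unfolded lunit_functor_def] category_one_cat
      functor_simps[OF is_cat_iso_functor] category_simps
      inv_into_prod_functor lunit_functor_def elim!: psetE)

section \<open>Unit laws of sequential composition\<close>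

lemma lens_iso_seq_id_left:
  assumes l: "ala_lens small l"
  shows "lens_iso lunit_functor (seq_lens (id_lens (src l)) l) l"
  by (rule lens_isoI)
    (auto simp: seq_lens_sel is_cat_iso_lunit lens_facts[OF l] category_simps[OF ala_lens_src[OF l]]
      category_simps[OF ala_lens_tgt[OF l]]
      category_simps[OF ala_lens_params[OF l]] elim!: psetE,
      auto simp: lunit_functor_def)

lemma lens_iso_seq_id_right:
  assumes l: "ala_lens small l"
  shows "lens_iso runit_functor (seq_lens l (id_lens (tgt l))) l"
  by (rule lens_isoI)
    (auto simp: seq_lens_sel is_cat_iso_runit lens_facts[OF l] category_simps[OF ala_lens_src[OF l]]
      category_simps[OF ala_lens_tgt[OF l]]
      category_simps[OF ala_lens_params[OF l]] elim!: psetE,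
      auto simp: runit_functor_def)

section \<open>Naturality squares, with parameters P x 1 on one side and 1 x Q on the other\<close>

lemma is_cat_iso_swap_unit:
  assumes "category P" "category Q" and \<alpha>: "is_cat_iso P Q \<alpha>"
  shows "is_cat_iso (prod_cat P one_cat) (prod_cat one_cat Q)
    (comp_functor swap_functor (prod_functor id_functor \<alpha>))"
  by (rule is_cat_iso_comp[OF is_cat_iso_swap is_cat_iso_prod])
    (simp_all add: assms is_cat_iso_id category_one_cat)

text \<open>The assumptions say that G, F and \<alpha> carry k to l strictly. The iso-lenses add
  only a trivial parameter and identities, so both composites perform the same puts. One argument
  thus covers the associator, both unitors and the braiding.\<close>

lemma lens_iso_natural:
  assumes k: "ala_lens small k" and l: "ala_lens small l"
    and F: "is_cat_iso (tgt k) (tgt l) F" and G: "is_cat_iso (src k) (src l) G"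
    and \<alpha>: "is_cat_iso (params k) (params l) \<alpha>"
    and obj: "\<And>p X. \<lbrakk>p \<in> Obj (params k); X \<in> Obj (src k)\<rbrakk>
      \<Longrightarrow> fobj F (fobj (get k p) X) = fobj (get l (fobj \<alpha> p)) (fobj G X)"
    and arr: "\<And>p f. \<lbrakk>p \<in> Obj (params k); f \<in> Arr (src k)\<rbrakk>
      \<Longrightarrow> farr F (farr (get k p) f) = farr (get l (fobj \<alpha> p)) (farr G f)"
    and nt: "\<And>e X. \<lbrakk>e \<in> Arr (params k); X \<in> Obj (src k)\<rbrakk>
      \<Longrightarrow> farr F (get_nt k e X) = get_nt l (farr \<alpha> e) (fobj G X)"
    and put: "\<And>p X v. \<lbrakk>p \<in> Obj (params k); X \<in> Obj (src k); v \<in> Arr (tgt k);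
        Dom (tgt k) v = fobj (get k p) X\<rbrakk>
      \<Longrightarrow> farr \<alpha> (put_upd k p X v) = put_upd l (fobj \<alpha> p) (fobj G X) (farr F v)
        \<and> farr G (put_req k p X v) = put_req l (fobj \<alpha> p) (fobj G X) (farr F v)
        \<and> farr F (put_self k p X v) = put_self l (fobj \<alpha> p) (fobj G X) (farr F v)"
  shows "lens_iso (comp_functor swap_functor (prod_functor id_functor \<alpha>))
    (seq_lens k (iso_lens (tgt k) (tgt l) F)) (seq_lens (iso_lens (src k) (src l) G) l)"
proof -
  note fs = is_cat_iso_functor[OF F] is_cat_iso_functor[OF G] is_cat_iso_functor[OF \<alpha>]
  note s = lens_facts[OF k] lens_facts[OF l] functor_simps[OF fs(1)] functor_simps[OF fs(2)]
    functor_simps[OF fs(3)] category_simps[OF ala_lens_src[OF k]]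
      category_simps[OF ala_lens_tgt[OF k]]
    category_simps[OF ala_lens_src[OF l]] category_simps[OF ala_lens_tgt[OF l]]
    category_simps[OF ala_lens_params[OF k]] category_simps[OF ala_lens_params[OF l]]
    is_cat_iso_inv_into[OF F] is_cat_iso_inv_into[OF G]
  let ?k = "seq_lens k (iso_lens (tgt k) (tgt l) F)"
    and ?l = "seq_lens (iso_lens (src k) (src l) G) l"
  let ?\<gamma> = "comp_functor swap_functor (prod_functor id_functor \<alpha>) :: 'a ufun"
  show ?thesis
  proof (rule lens_isoI)
    fix r X w
    assume "r \<in> Obj (params ?k)" "X \<in> Obj (src ?k)" "w \<in> Arr (tgt ?k)"
      "Dom (tgt ?k) w = fobj (get ?k r) X"
    then obtain p where r: "r = Pr p Star" and p: "p \<in> Obj (params k)" and X: "X \<in> Obj (src k)"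
      and w: "w \<in> Arr (tgt l)" "Dom (tgt l) w = fobj F (fobj (get k p) X)"
      by (auto simp: seq_lens_sel elim!: psetE)
    \<comment> \<open>The assumption \<open>put\<close> concerns updates in the target of k, so the
      given update w is pulled back along F.\<close>
    define v where "v = inv_into (Arr (tgt k)) (farr F) w"
    have v: "v \<in> Arr (tgt k)" "w = farr F v"
      using w by (simp_all add: v_def s)
    \<comment> \<open>Equality after applying F suffices by injectivity, and makes v an admissible
      put argument for k at X.\<close>
    then have "fobj F (Dom (tgt k) v) = fobj F (fobj (get k p) X)"
      using w by (simp add: s)
    then have Dv: "Dom (tgt k) v = fobj (get k p) X"
      using is_cat_iso_inj[OF F] v p X by (simp add: s)
    have eq: "put_upd l (fobj \<alpha> p) (fobj G X) (farr F v) = farr \<alpha> (put_upd k p X v)"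
      "put_req l (fobj \<alpha> p) (fobj G X) (farr F v) = farr G (put_req k p X v)"
      "put_self l (fobj \<alpha> p) (fobj G X) (farr F v) = farr F (put_self k p X v)"
      using put[OF p X v(1) Dv] by auto
    \<comment> \<open>In \<open>?l\<close>, \<open>put_self\<close> ends with \<open>get\<close>
      applied to an identity. This equation places that identity at the codomain of
      \<open>farr F (put_self k p X v)\<close>, so that it cancels.\<close>
    have "fobj (get l (fobj \<alpha> (Cod (params k) (put_upd k p X v))))
      (fobj G (Cod (src k) (put_req k p X v)))
      = fobj F (fobj (get k (Cod (params k) (put_upd k p X v))) (Cod (src k) (put_req k p X v)))"
      using p X v Dv by (subst obj) (simp_all add: s)
    then show "farr ?\<gamma> (put_upd ?k r X w) = put_upd ?l (fobj ?\<gamma> r) X w \<and>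
      put_req ?k r X w = put_req ?l (fobj ?\<gamma> r) X w \<and> put_self ?k r X w
        = put_self ?l (fobj ?\<gamma> r) X w"
      using p X v Dv by (simp add: r seq_lens_sel swap_functor_def eq s)
  qed (use \<alpha> in \<open>auto simp: seq_lens_sel obj[symmetric] arr nt[symmetric] swap_functor_def s
    elim!: psetE
      intro!: is_cat_iso_swap_unit[unfolded swap_functor_def]\<close>)
qed

section \<open>The symmetric monoidal structure\<close>

lemma lens_class_eqI:
  assumes "ala_lens small k" "ala_lens small l" "lens_iso \<alpha> k l"
  shows "lens_class small k = lens_class small l"
  unfolding lens_class_def
  by (rule equiv_class_eq[OF equiv_lens_eq])
    (use assms in \<open>auto simp: lens_eq_def lens_equivalent_iff_lens_iso\<close>)

lemma lens_class_self: "ala_lens small l \<Longrightarrow> l \<in> lens_class small l"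
  using lens_iso_refl by (auto simp: lens_class_def lens_eq_def lens_equivalent_iff_lens_iso)

lemma lens_classD:
  assumes "k \<in> lens_class small l"
  shows "(l, k) \<in> lens_eq small" "src k = src l" "tgt k = tgt l"
proof -
  show *: "(l, k) \<in> lens_eq small"
    using assms by (simp add: lens_class_def)
  show "src k = src l" "tgt k = tgt l"
    using * by (auto simp: lens_eq_def lens_equivalent_def)
qed

text \<open>Equivalent lenses share source and target, and l lies in its own class. So both images
  of the class are singletons and \<open>the_elem\<close> returns the intended object.\<close>

lemma lens_class_hom:
  assumes "ala_lens small l" "src l = X" "tgt l = Y"
  shows "lens_class small l \<in> hom (ALaLens small) X Y"
proof -
  have "src ` lens_class small l = {X}" "tgt ` lens_class small l = {Y}"
    using lens_class_self[OF assms(1)] lens_classD assms by blast+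
  then show ?thesis
    using assms by (auto simp: hom_def ALaLens_def lens_class_def intro: quotientI)
qed

lemma ALaLens_homE:
  assumes "f \<in> hom (ALaLens small) X Y"
  obtains l where "ala_lens small l" "f = lens_class small l" "src l = X" "tgt l = Y"
proof -
  from assms obtain l where l: "ala_lens small l" "f = lens_class small l"
    by (auto simp: hom_def ALaLens_def lens_class_def elim!: quotientE)
  moreover have "f \<in> hom (ALaLens small) (src l) (tgt l)"
    using l lens_class_hom by simp
  ultimately show thesis
    using assms that by (auto simp: hom_def)
qed

lemma lens_eq_seq:
  assumes "(k, k') \<in> lens_eq small" "(l, l') \<in> lens_eq small" "tgt k = src l"
  shows "(seq_lens k l, seq_lens k' l') \<in> lens_eq small"
proof -
  obtain \<alpha> \<beta> where "lens_iso \<alpha> k k'" "lens_iso \<beta> l l'"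
    using assms by (auto simp: lens_eq_def lens_equivalent_iff_lens_iso)
  \<comment> \<open>Composability of k' and l' is inherited, because equivalence fixes sources and
    targets.\<close>
  then show ?thesis
    using assms lens_iso_seq[of k l \<alpha> k' \<beta> l'] ala_lens_seq[of k l] ala_lens_seq[of k' l']
      lens_iso_tgt[of \<alpha> k k'] lens_iso_src[of \<beta> l l']
    by (auto simp: lens_eq_def lens_equivalent_iff_lens_iso)
qed

lemma lens_eq_par:
  assumes "(k, k') \<in> lens_eq small" "(l, l') \<in> lens_eq small"
  shows "(par_lens k l, par_lens k' l') \<in> lens_eq small"
proof -
  obtain \<alpha> \<beta> where "lens_iso \<alpha> k k'" "lens_iso \<beta> l l'"
    using assms by (auto simp: lens_eq_def lens_equivalent_iff_lens_iso)
  then show ?thesis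
    using assms lens_iso_par[of \<alpha> k k' \<beta> l l']
    by (auto simp: lens_eq_def lens_equivalent_iff_lens_iso ala_lens_par)
qed

text \<open>A union over all representatives replaces a choice of one. Congruence makes all united
  classes equal, and nonemptiness collapses the union. Congruence is required only at the given k
  and l, where composability is known.\<close>

lemma lens_class_UN:
  assumes "ala_lens small k" "ala_lens small l"
    and "\<And>k' l'. \<lbrakk>(k, k') \<in> lens_eq small; (l, l') \<in> lens_eq small\<rbrakk>
      \<Longrightarrow> (c k l, c k' l') \<in> lens_eq small"
  shows "(\<Union>k' \<in> lens_class small k. \<Union>l' \<in> lens_class small l. lens_class small (c k' l'))
    = lens_class small (c k l)"
proof -
  have "lens_class small (c k' l') = lens_class small (c k l)"
    if "k' \<in> lens_class small k" "l' \<in> lens_class small l" for k' l'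
    unfolding lens_class_def
    using equiv_class_eq[OF equiv_lens_eq assms(3)[OF that[THEN lens_classD(1)]]] by simp
  then show ?thesis
    using lens_class_self[OF assms(1)] lens_class_self[OF assms(2)] by blast
qed

lemma ALaLens_Comp:
  assumes "ala_lens small k" "ala_lens small l" "tgt k = src l"
  shows "lens_class small k \<Zsemi>\<^bsub>ALaLens small\<^esub> lens_class small l = lens_class small (seq_lens k l)"
  using lens_class_UN[OF assms(1,2), of seq_lens] lens_eq_seq[OF _ _ assms(3)]
  by (simp add: ALaLens_def)

lemma ALaLens_tensa:
  assumes "ala_lens small k" "ala_lens small l"
  shows "tensa (ALaLens small) (lens_class small k) (lens_class small l)
    = lens_class small (par_lens k l)"
  using lens_class_UN[OF assms, of par_lens] lens_eq_par by (simp add: ALaLens_def)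

section \<open>Classes of iso-lenses as images of isomorphisms of categories\<close>

definition iso_class :: "'a ucat \<Rightarrow> 'a ucat \<Rightarrow> 'a ufun \<Rightarrow> 'a lens set" where
  "iso_class A B F = lens_class small (iso_lens A B F)"

lemma ALaLens_Ide: "Ide (ALaLens small) A = lens_class small (id_lens A)"
  by (simp add: ALaLens_def)

lemma ALaLens_Ide_iso:
  assumes "small_category small A"
  shows "Ide (ALaLens small) A = iso_class A A id_functor"
  unfolding ALaLens_Ide iso_class_def using assms
  by (intro lens_class_eqI[OF _ _ id_lens_iso_lens] ala_lens_id ala_lens_iso is_cat_iso_id)

text \<open>With the structural arrows in the form \<open>iso_class\<close>, the composites in the
  coherence laws are computed as composites of functors.\<close>

lemma ALaLens_sel:
  "Obj (ALaLens small) = {A. small_category small A}"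
  "munit (ALaLens small) = one_cat" "tens (ALaLens small) = prod_cat"
  "associator (ALaLens small) A B C
    = iso_class (prod_cat (prod_cat A B) C) (prod_cat A (prod_cat B C)) assoc_functor"
  "lunitor (ALaLens small) A = iso_class (prod_cat one_cat A) A lunit_functor"
  "runitor (ALaLens small) A = iso_class (prod_cat A one_cat) A runit_functor"
  "braiding (ALaLens small) A B = iso_class (prod_cat A B) (prod_cat B A) swap_functor"
  by (simp_all add: ALaLens_def iso_class_def)

lemma iso_class_hom:
  assumes "small_category small A" "small_category small B" "is_cat_iso A B F"
  shows "iso_class A B F \<in> hom (ALaLens small) A B"
  unfolding iso_class_def by (intro lens_class_hom ala_lens_iso assms) simp_all

lemma iso_class_cong:
  assumes "functor_eq A F G" "is_cat_iso A B F" "is_cat_iso A B G"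
    and "small_category small A" "small_category small B"
  shows "iso_class A B F = iso_class A B G"
  unfolding iso_class_def
  by (rule lens_class_eqI[OF _ _ lens_iso_iso_lens_cong]) (simp_all add: ala_lens_iso assms)

lemma iso_class_Comp:
  assumes "small_category small A" "small_category small B" "small_category small C"
    "is_cat_iso A B F" "is_cat_iso B C G"
  shows "iso_class A B F \<Zsemi>\<^bsub>ALaLens small\<^esub> iso_class B C G = iso_class A C (comp_functor F G)"
proof -
  have "lens_class small (seq_lens (iso_lens A B F) (iso_lens B C G))
    = lens_class small (iso_lens A C (comp_functor F G))"
    by (rule lens_class_eqI[OF ala_lens_seq ala_lens_iso lens_iso_seq_iso_lens])
      (simp_all add: ala_lens_iso is_cat_iso_comp[OF assms(4,5)] small_category_category assms)
  then show ?thesis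
    using assms by (simp add: iso_class_def ALaLens_Comp ala_lens_iso)
qed

lemma iso_class_tensa:
  assumes "small_category small A" "small_category small B" "small_category small A'"
    "small_category small B'"
    "is_cat_iso A B F" "is_cat_iso A' B' G"
  shows "tensa (ALaLens small) (iso_class A B F) (iso_class A' B' G)
    = iso_class (prod_cat A A') (prod_cat B B') (prod_functor F G)"
proof -
  have "lens_class small (par_lens (iso_lens A B F) (iso_lens A' B' G))
    = lens_class small (iso_lens (prod_cat A A') (prod_cat B B') (prod_functor F G))"
    by (rule lens_class_eqI[OF ala_lens_par ala_lens_iso lens_iso_par_iso_lens])
      (simp_all add: ala_lens_iso is_cat_iso_prod small_category_prod_cat small_category_category
        assms)
  then show ?thesis
    using assms by (simp add: iso_class_def ALaLens_tensa ala_lens_iso)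
qed

text \<open>The inverse is the class of the inverse functor. The composites of F and G are
  identities only up to \<open>functor_eq\<close>, which \<open>iso_class_cong\<close> turns into
  equality of classes.\<close>

lemma iso_class_is_iso:
  assumes "small_category small A" "small_category small B" "is_cat_iso A B F"
  shows "is_iso (ALaLens small) (iso_class A B F)"
proof -
  obtain G where G: "is_cat_iso B A G" "functor_eq A (comp_functor F G) id_functor"
    "functor_eq B (comp_functor G F) id_functor"
    by (rule is_cat_isoE[OF assms(3)]) (auto simp: functor_eq_def)
  have F: "iso_class A B F \<in> hom (ALaLens small) A B" "iso_class B A G \<in> hom (ALaLens small) B A"
    using assms G by (auto intro: iso_class_hom)
  have "iso_class A B F \<Zsemi>\<^bsub>ALaLens small\<^esub> iso_class B A G = Ide (ALaLens small) A"
    "iso_class B A G \<Zsemi>\<^bsub>ALaLens small\<^esub> iso_class A B F = Ide (ALaLens small) B"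
    by (simp_all add: iso_class_Comp ALaLens_Ide_iso assms G)
      (intro iso_class_cong is_cat_iso_comp[OF assms(3) G(1)] is_cat_iso_comp[OF G(1) assms(3)]
        is_cat_iso_id assms G)+
  then show ?thesis
    using F unfolding is_iso_def hom_def by auto
qed

section \<open>Naturality of associator, unitors and braiding\<close>

lemma assoc_natural:
  assumes f: "ala_lens small f" and g: "ala_lens small g" and h: "ala_lens small h"
  shows "lens_class small (seq_lens (par_lens (par_lens f g) h)
      (iso_lens (prod_cat (prod_cat (tgt f) (tgt g)) (tgt h))
        (prod_cat (tgt f) (prod_cat (tgt g) (tgt h))) assoc_functor))
    = lens_class small (seq_lens
      (iso_lens (prod_cat (prod_cat (src f) (src g)) (src h))
        (prod_cat (src f) (prod_cat (src g) (src h))) assoc_functor) (par_lens f (par_lens g h)))"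
proof -
  note c = ala_lens_simps(1,2,4-6)[OF f] ala_lens_simps(1,2,4-6)[OF g] ala_lens_simps(1,2,4-6)[OF h]
  let ?k = "par_lens (par_lens f g) h" and ?l = "par_lens f (par_lens g h)"
  \<comment> \<open>Sources, targets and parameters are all rebracketed by the same formula, since
    the operations of both threefold products have the same three components.\<close>
  have "lens_iso (comp_functor swap_functor (prod_functor id_functor assoc_functor))
    (seq_lens ?k (iso_lens (tgt ?k) (tgt ?l) assoc_functor))
      (seq_lens (iso_lens (src ?k) (src ?l) assoc_functor) ?l)"
    by (rule lens_iso_natural)
      (auto simp: par_lens_sel is_cat_iso_assoc ala_lens_par ala_lens_id small_category_one_cat
        f g h c elim!: psetE, auto simp: assoc_functor_def par_lens_sel)
  moreover have "ala_lens small (seq_lens ?k (iso_lens (tgt ?k) (tgt ?l) assoc_functor))"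
    "ala_lens small (seq_lens (iso_lens (src ?k) (src ?l) assoc_functor) ?l)"
    by (intro ala_lens_seq ala_lens_iso; simp add: par_lens_sel is_cat_iso_assoc ala_lens_par
        ala_lens_id small_category_prod_cat small_category_one_cat f g h c)+
  ultimately show ?thesis
    using lens_class_eqI by (simp add: par_lens_sel)
qed

text \<open>The factor \<open>id_lens one_cat\<close> contributes one object, one arrow and one
  parameter. The second projection is therefore an isomorphism on sources, targets and parameters,
  and carries the parallel composite to f.\<close>

lemma lunit_natural:
  assumes f: "ala_lens small f"
  shows "lens_class small (seq_lens (par_lens (id_lens one_cat) f)
      (iso_lens (prod_cat one_cat (tgt f)) (tgt f) lunit_functor))
    = lens_class small (seq_lens
      (iso_lens (prod_cat one_cat (src f)) (src f) lunit_functor) f)"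
proof -
  note c = ala_lens_simps(1,2,4-6)[OF f]
  let ?k = "par_lens (id_lens one_cat) f" and ?l = "f"
  have "lens_iso (comp_functor swap_functor (prod_functor id_functor lunit_functor))
    (seq_lens ?k (iso_lens (tgt ?k) (tgt ?l) lunit_functor))
      (seq_lens (iso_lens (src ?k) (src ?l) lunit_functor) ?l)"
    by (rule lens_iso_natural)
      (auto simp: par_lens_sel is_cat_iso_lunit ala_lens_par ala_lens_id small_category_one_cat
        f c elim!: psetE, auto simp: lunit_functor_def par_lens_sel)
  moreover have "ala_lens small (seq_lens ?k (iso_lens (tgt ?k) (tgt ?l) lunit_functor))"
    "ala_lens small (seq_lens (iso_lens (src ?k) (src ?l) lunit_functor) ?l)"
    by (intro ala_lens_seq ala_lens_iso; simp add: par_lens_sel is_cat_iso_lunit ala_lens_par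
        ala_lens_id small_category_prod_cat small_category_one_cat f c)+
  ultimately show ?thesis
    using lens_class_eqI by (simp add: par_lens_sel)
qed

lemma runit_natural:
  assumes f: "ala_lens small f"
  shows "lens_class small (seq_lens (par_lens f (id_lens one_cat))
      (iso_lens (prod_cat (tgt f) one_cat) (tgt f) runit_functor))
    = lens_class small (seq_lens
      (iso_lens (prod_cat (src f) one_cat) (src f) runit_functor) f)"
proof -
  note c = ala_lens_simps(1,2,4-6)[OF f]
  let ?k = "par_lens f (id_lens one_cat)" and ?l = "f"
  have "lens_iso (comp_functor swap_functor (prod_functor id_functor runit_functor))
    (seq_lens ?k (iso_lens (tgt ?k) (tgt ?l) runit_functor))
      (seq_lens (iso_lens (src ?k) (src ?l) runit_functor) ?l)"
    by (rule lens_iso_natural)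
      (auto simp: par_lens_sel is_cat_iso_runit ala_lens_par ala_lens_id small_category_one_cat
        f c elim!: psetE, auto simp: runit_functor_def par_lens_sel)
  moreover have "ala_lens small (seq_lens ?k (iso_lens (tgt ?k) (tgt ?l) runit_functor))"
    "ala_lens small (seq_lens (iso_lens (src ?k) (src ?l) runit_functor) ?l)"
    by (intro ala_lens_seq ala_lens_iso; simp add: par_lens_sel is_cat_iso_runit ala_lens_par
        ala_lens_id small_category_prod_cat small_category_one_cat f c)+
  ultimately show ?thesis
    using lens_class_eqI by (simp add: par_lens_sel)
qed

lemma swap_natural:
  assumes f: "ala_lens small f" and g: "ala_lens small g"
  shows "lens_class small (seq_lens (par_lens f g)
      (iso_lens (prod_cat (tgt f) (tgt g)) (prod_cat (tgt g) (tgt f)) swap_functor))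
    = lens_class small (seq_lens
      (iso_lens (prod_cat (src f) (src g)) (prod_cat (src g) (src f)) swap_functor) (par_lens g f))"
proof -
  note c = ala_lens_simps(1,2,4-6)[OF f] ala_lens_simps(1,2,4-6)[OF g]
  let ?k = "par_lens f g" and ?l = "par_lens g f"
  have "lens_iso (comp_functor swap_functor (prod_functor id_functor swap_functor))
    (seq_lens ?k (iso_lens (tgt ?k) (tgt ?l) swap_functor))
      (seq_lens (iso_lens (src ?k) (src ?l) swap_functor) ?l)"
    by (rule lens_iso_natural)
      (auto simp: par_lens_sel is_cat_iso_swap ala_lens_par ala_lens_id small_category_one_cat
        f g c elim!: psetE, auto simp: swap_functor_def par_lens_sel)
  moreover have "ala_lens small (seq_lens ?k (iso_lens (tgt ?k) (tgt ?l) swap_functor))"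
    "ala_lens small (seq_lens (iso_lens (src ?k) (src ?l) swap_functor) ?l)"
    by (intro ala_lens_seq ala_lens_iso; simp add: par_lens_sel is_cat_iso_swap ala_lens_par
        ala_lens_id small_category_prod_cat small_category_one_cat f g c)+
  ultimately show ?thesis
    using lens_class_eqI by (simp add: par_lens_sel)
qed

lemma interchange:
  assumes k: "ala_lens small k" and l: "ala_lens small l" and k': "ala_lens small k'"
    and l': "ala_lens small l'"
    and kl: "tgt k = src l" "tgt k' = src l'"
  shows "lens_class small (par_lens (seq_lens k l) (seq_lens k' l'))
    = lens_class small (seq_lens (par_lens k k') (par_lens l l'))"
  using lens_iso_interchange[OF assms] assms
  by (metis lens_class_eqI ala_lens_par ala_lens_seq par_lens_sel(1,2))

section \<open>The axioms, verified on representatives\<close>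

lemma category_ALaLens: "category (ALaLens small)"
proof
  fix f X Y assume "f \<in> Arr (ALaLens small)"
  then have "f \<in> hom (ALaLens small) (Dom (ALaLens small) f) (Cod (ALaLens small) f)"
    by (simp add: hom_def)
  then show "Dom (ALaLens small) f \<in> Obj (ALaLens small)"
    "Cod (ALaLens small) f \<in> Obj (ALaLens small)"
    by (metis (mono_tags) ALaLens_homE ALaLens_sel(1) ala_lens_simps(1,2) mem_Collect_eq)+
next
  fix X assume "X \<in> Obj (ALaLens small)"
  then show "Ide (ALaLens small) X \<in> hom (ALaLens small) X X"
    by (simp add: ALaLens_sel ALaLens_Ide lens_class_hom ala_lens_id)
next
  fix f g X Y Z
  assume f: "f \<in> hom (ALaLens small) X Y" and g: "g \<in> hom (ALaLens small) Y Z"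
  show "f \<Zsemi>\<^bsub>ALaLens small\<^esub> g \<in> hom (ALaLens small) X Z"
    using ALaLens_homE[OF f] ALaLens_homE[OF g]
    by (smt (verit) ALaLens_Comp ala_lens_seq lens_class_hom seq_lens_sel(1,2))
next
  fix f X Y assume "f \<in> hom (ALaLens small) X Y"
  then obtain l where l: "ala_lens small l" "f = lens_class small l" "src l = X" "tgt l = Y"
    by (rule ALaLens_homE)
  note s = ala_lens_simps(1,2)[OF l(1)]
  show "Ide (ALaLens small) X \<Zsemi>\<^bsub>ALaLens small\<^esub> f = f"
    using lens_class_eqI[OF _ _ lens_iso_seq_id_left[OF l(1)]] l s
    by (auto simp: ALaLens_Ide ALaLens_Comp ala_lens_id ala_lens_seq)
  show "f \<Zsemi>\<^bsub>ALaLens small\<^esub> Ide (ALaLens small) Y = f"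
    using lens_class_eqI[OF _ _ lens_iso_seq_id_right[OF l(1)]] l s
    by (auto simp: ALaLens_Ide ALaLens_Comp ala_lens_id ala_lens_seq)
next
  fix f g h W X Y Z
  assume f: "f \<in> hom (ALaLens small) W X" and g: "g \<in> hom (ALaLens small) X Y"
    and h: "h \<in> hom (ALaLens small) Y Z"
  obtain k where k: "ala_lens small k" "f = lens_class small k" "src k = W" "tgt k = X"
    by (rule ALaLens_homE[OF f])
  obtain l where l: "ala_lens small l" "g = lens_class small l" "src l = X" "tgt l = Y"
    by (rule ALaLens_homE[OF g])
  obtain m where m: "ala_lens small m" "h = lens_class small m" "src m = Y" "tgt m = Z"
    by (rule ALaLens_homE[OF h])
  show "(f \<Zsemi>\<^bsub>ALaLens small\<^esub> g) \<Zsemi>\<^bsub>ALaLens small\<^esub> h = f \<Zsemi>\<^bsub>ALaLens small\<^esub> (g \<Zsemi>\<^bsub>ALaLens small\<^esub> h)"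
    using lens_class_eqI[OF _ _ lens_iso_seq_assoc[OF k(1) l(1) m(1)]] k l m
    by (auto simp: ALaLens_Comp ala_lens_seq seq_lens_sel(1,2))
qed

lemma symmetric_monoidal_category_ALaLens: "symmetric_monoidal_category (ALaLens small)"
proof -
  let ?M = "ALaLens small"
  note ok = small_category_prod_cat small_category_one_cat small_category_category
    category_prod_cat category_one_cat is_cat_iso_id is_cat_iso_prod is_cat_iso_assoc
      is_cat_iso_lunit
    is_cat_iso_runit is_cat_iso_swap is_cat_iso_comp
  note iso = iso_class_Comp iso_class_tensa ALaLens_Ide_iso ok
  \<comment> \<open>These are the partial composites on the two sides of the hexagon. They are
    supplied explicitly because the middle category occurs only in the premises of
    \<open>is_cat_iso_comp\<close>; \<open>comp'\<close> does the same for the pentagon.\<close>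
  have comp:
    "is_cat_iso (prod_cat (prod_cat A B) C) (prod_cat (prod_cat B C) A)
      (comp_functor assoc_functor swap_functor)"
    "is_cat_iso (prod_cat (prod_cat A B) C) (prod_cat B (prod_cat A C))
      (comp_functor (prod_functor swap_functor id_functor) assoc_functor)"
    if "small_category small A" "small_category small B" "small_category small C" for A B C
    using that by - (assumption | rule ok)+
  have comp':
    "is_cat_iso (prod_cat (prod_cat (prod_cat A B) C) D) (prod_cat A (prod_cat (prod_cat B C) D))
      (comp_functor (prod_functor assoc_functor id_functor) assoc_functor)"
    if "small_category small A" "small_category small B" "small_category small C"
      "small_category small D"
    for A B C D
    using that by - (assumption | rule ok)+
  interpret category ?M
    by (fact category_ALaLens)
  show ?thesis
  proof
    fix f X X' assume "f \<in> hom ?M X X'"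
    then obtain k where k: "ala_lens small k" "f = lens_class small k" "src k = X" "tgt k = X'"
      by (rule ALaLens_homE)
    note o = ala_lens_simps(1,2)[OF k(1)]
    show "tensa ?M (Ide ?M (munit ?M)) f \<Zsemi>\<^bsub>?M\<^esub> lunitor ?M X' = lunitor ?M X \<Zsemi>\<^bsub>?M\<^esub> f"
      using lunit_natural[OF k(1)] k o
      by (auto simp: ALaLens_sel ALaLens_Ide iso_class_def ALaLens_tensa ALaLens_Comp ala_lens_par
        ala_lens_id
          ala_lens_iso ala_lens_seq ok par_lens_sel(1,2))
    show "tensa ?M f (Ide ?M (munit ?M)) \<Zsemi>\<^bsub>?M\<^esub> runitor ?M X' = runitor ?M X \<Zsemi>\<^bsub>?M\<^esub> f"
      using runit_natural[OF k(1)] k o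
      by (auto simp: ALaLens_sel ALaLens_Ide iso_class_def ALaLens_tensa ALaLens_Comp ala_lens_par
        ala_lens_id
          ala_lens_iso ala_lens_seq ok par_lens_sel(1,2))
    fix g Y Y' assume "g \<in> hom ?M Y Y'"
    then obtain l where l: "ala_lens small l" "g = lens_class small l" "src l = Y" "tgt l = Y'"
      by (rule ALaLens_homE)
    note o' = ala_lens_simps(1,2)[OF l(1)]
    show "tensa ?M f g \<in> hom ?M (tens ?M X Y) (tens ?M X' Y')"
      using k l by (simp add: ALaLens_sel ALaLens_tensa lens_class_hom ala_lens_par
        par_lens_sel(1,2))
    show "tensa ?M f g \<Zsemi>\<^bsub>?M\<^esub> braiding ?M X' Y' = braiding ?M X Y \<Zsemi>\<^bsub>?M\<^esub> tensa ?M g f"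
      using swap_natural[OF k(1) l(1)] k o l o'
      by (auto simp: ALaLens_sel iso_class_def ALaLens_tensa ALaLens_Comp ala_lens_par
          ala_lens_iso ala_lens_seq ok par_lens_sel(1,2))
    {
      fix h Z Z' assume "h \<in> hom ?M Z Z'"
      then obtain m where m: "ala_lens small m" "h = lens_class small m" "src m = Z" "tgt m = Z'"
        by (rule ALaLens_homE)
      note o'' = ala_lens_simps(1,2)[OF m(1)]
      show "tensa ?M (tensa ?M f g) h \<Zsemi>\<^bsub>?M\<^esub> associator ?M X' Y' Z'
        = associator ?M X Y Z \<Zsemi>\<^bsub>?M\<^esub> tensa ?M f (tensa ?M g h)"
        using assoc_natural[OF k(1) l(1) m(1)] k o l o' m o''
        by (auto simp: ALaLens_sel iso_class_def ALaLens_tensa ALaLens_Comp ala_lens_par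
            ala_lens_iso ala_lens_seq ok par_lens_sel(1,2))
    }
    fix f' X'' g' Y'' assume "f' \<in> hom ?M X' X''" "g' \<in> hom ?M Y' Y''"
    then obtain k' l' where k': "ala_lens small k'" "f' = lens_class small k'" "src k' = X'"
      "tgt k' = X''"
      and l': "ala_lens small l'" "g' = lens_class small l'" "src l' = Y'" "tgt l' = Y''"
      by (metis ALaLens_homE)
    then show "tensa ?M (f \<Zsemi>\<^bsub>?M\<^esub> f') (g \<Zsemi>\<^bsub>?M\<^esub> g') = tensa ?M f g \<Zsemi>\<^bsub>?M\<^esub> tensa ?M f' g'"
      using interchange[OF k(1) k'(1) l(1) l'(1)] k l
      by (simp add: ALaLens_tensa ALaLens_Comp ala_lens_par ala_lens_seq par_lens_sel(1,2)
          seq_lens_sel(1,2))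
  next
    fix X Y assume XY: "X \<in> Obj ?M" "Y \<in> Obj ?M"
    then show "tensa ?M (Ide ?M X) (Ide ?M Y) = Ide ?M (tens ?M X Y)"
      by (simp add: ALaLens_sel iso, intro iso_class_cong)
        ((auto simp: functor_eq_def elim!: psetE)[1], (assumption | rule ok)+)
    show "associator ?M X (munit ?M) Y \<Zsemi>\<^bsub>?M\<^esub> tensa ?M (Ide ?M X) (lunitor ?M Y)
        = tensa ?M (runitor ?M X) (Ide ?M Y)"
      using XY by (simp add: ALaLens_sel iso, intro iso_class_cong)
        ((auto simp: functor_eq_def assoc_functor_def lunit_functor_def runit_functor_def
          elim!: psetE)[1], (assumption | rule ok)+)
    show "braiding ?M X Y \<Zsemi>\<^bsub>?M\<^esub> braiding ?M Y X = Ide ?M (tens ?M X Y)"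
      using XY by (simp add: ALaLens_sel iso, intro iso_class_cong)
        ((auto simp: functor_eq_def swap_functor_def elim!: psetE)[1], (assumption | rule ok)+)
    fix Z assume Z: "Z \<in> Obj ?M"
    \<comment> \<open>Both functors send ((x, y), z) to (y, (z, x)).\<close>
    show "associator ?M X Y Z \<Zsemi>\<^bsub>?M\<^esub> braiding ?M X (tens ?M Y Z) \<Zsemi>\<^bsub>?M\<^esub> associator ?M Y Z X
          = tensa ?M (braiding ?M X Y) (Ide ?M Z) \<Zsemi>\<^bsub>?M\<^esub> associator ?M Y X Z
            \<Zsemi>\<^bsub>?M\<^esub> tensa ?M (Ide ?M Y) (braiding ?M X Z)"
      using XY Z by (simp add: ALaLens_sel iso comp, intro iso_class_cong)
        ((auto simp: functor_eq_def swap_functor_def assoc_functor_def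
          elim!: psetE)[1], (assumption | rule ok)+)
    fix W assume W: "W \<in> Obj ?M"
    \<comment> \<open>Both functors send (((w, x), y), z) to (w, (x, (y, z))).\<close>
    show "associator ?M (tens ?M W X) Y Z \<Zsemi>\<^bsub>?M\<^esub> associator ?M W X (tens ?M Y Z)
          = tensa ?M (associator ?M W X Y) (Ide ?M Z) \<Zsemi>\<^bsub>?M\<^esub> associator ?M W (tens ?M X Y) Z
            \<Zsemi>\<^bsub>?M\<^esub> tensa ?M (Ide ?M W) (associator ?M X Y Z)"
      using XY Z W by (simp add: ALaLens_sel iso comp', intro iso_class_cong)
        ((auto simp: functor_eq_def assoc_functor_def elim!: psetE)[1], (assumption | rule ok)+)
  \<comment> \<open>What remains is closure of the objects under unit and product, and that the
    structural arrows are well typed and, for associator and unitors, invertible.\<close>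
  qed (auto simp: ALaLens_sel ok intro!: iso_class_hom iso_class_is_iso)
qed

end

theorem theorem3:
  fixes small :: "'a univ set \<Rightarrow> bool"
  assumes "smallness small"
  shows "equiv {l. ala_lens small l} (lens_eq small) \<and>
    (\<forall>k k' l l'. (k, k') \<in> lens_eq small \<longrightarrow> (l, l') \<in> lens_eq small \<longrightarrow> tgt k = src l \<longrightarrow>
       (seq_lens k l, seq_lens k' l') \<in> lens_eq small) \<and>
    (\<forall>k k' l l'. (k, k') \<in> lens_eq small \<longrightarrow> (l, l') \<in> lens_eq small \<longrightarrow>
       (par_lens k l, par_lens k' l') \<in> lens_eq small) \<and>
    symmetric_monoidal_category (ALaLens small)"
proof -
  interpret smallness small
    by fact
  show ?thesis
    using equiv_lens_eq lens_eq_seq lens_eq_par symmetric_monoidal_category_ALaLens by blast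
qed

end
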